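(* Let $p$ be a prime and let $t\in\mathbb{C}_p^{\mathrm{br}}$, i.e. $t\in\mathbb{C}_p$ is such that the extension $\mathbb{Q}_p(t)/\mathbb{Q}_p$ has finite ramification. Then there is a finite extension $K$ of $\mathbb{Q}_p$ such that $t$ is the limit (in $\mathbb{C}_p$) of a sequence contained in the maximal unramified extension of $K$.
   Context: $\overline{\mathbb{Q}_p}$ is a fixed algebraic closure of $\mathbb{Q}_p$, $\mathbb{C}_p$ is the completion of $\overline{\mathbb{Q}_p}$ with respect to the unique extension of the $p$-adic valuation $v_p$, and $v_p$ also denotes its extension to $\mathbb{C}_p$. Finite extensions of $\mathbb{Q}_p$ and their maximal unramified extensions are taken inside $\overline{\mathbb{Q}_p}$. For $t\in\mathbb{C}_p$ (possibly transcendental over $\mathbb{Q}_p$), the ramification index of $\mathbb{Q}_p(t)/\mathbb{Q}_p$ is the index $[v_p(\mathbb{Q}_p(t)^* ):\mathbb{Z}]$. $\mathbb{C}_p^{\mathrm{br}}$ is the set of $t\in\mathbb{C}_p$ for which this index is finite. *)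

theory Defs
  imports
    "HOL-Algebra.Algebraic_Closure_Type"
    "HOL-Algebra.Generated_Fields"
    "HOL-Analysis.Elementary_Metric_Spaces"
begin

text \<open>
  The field \<open>\<complex>\<^sub>p\<close> is carried by a type \<open>'a\<close> that is both a field and a complete metric space;
  its subfields are sets, and the field-theoretic notions for them are those of
  \<^term>\<open>ring_of_type_algebra\<close>, the record of the field operations on \<open>'a\<close>.
\<close>

abbreviation CR :: "'a::field ring" where
  "CR \<equiv> ring_of_type_algebra"

text \<open>
  A model of the tower \<open>\<rat> \<subseteq> Qp \<subseteq> Qpbar \<subseteq> \<complex>\<^sub>p\<close>. The type class \<open>complete_space\<close> provides the
  completeness of \<open>'a\<close>, so that \<open>val_dist\<close> and \<open>Qpbar_dense\<close> say that \<open>'a\<close> is the completion of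
  \<open>Qpbar\<close>, and \<open>Qp_closure\<close> that \<open>Qp\<close> is the completion of \<open>\<rat>\<close>. These conditions determine the
  tower up to isomorphism, and \<open>v\<close> is the unique extension of the \<open>p\<close>-adic valuation. The value
  of \<open>v\<close> at \<open>0\<close> (conventionally infinity) is left unspecified and never used.
\<close>

locale padic_complex_field =
  fixes p :: nat
    and v :: "'a::{field_char_0, complete_space} \<Rightarrow> real"
    and Qp Qpbar :: "'a set"
  assumes prime_p: "prime p"
    and val_mult: "\<And>x y. x \<noteq> 0 \<Longrightarrow> y \<noteq> 0 \<Longrightarrow> v (x * y) = v x + v y"
    and val_add: "\<And>x y. x \<noteq> 0 \<Longrightarrow> y \<noteq> 0 \<Longrightarrow> x + y \<noteq> 0 \<Longrightarrow> v (x + y) \<ge> min (v x) (v y)"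
    and val_of_int: "\<And>n::int. n \<noteq> 0 \<Longrightarrow> v (of_int n) = real (multiplicity (int p) n)"
    and val_dist: "\<And>x y. dist x y = (if x = y then 0 else real p powr (- v (x - y)))"
    and Qp_closure: "Qp = closure (range of_rat)"
    and subfield_Qpbar: "subfield Qpbar CR"
    and Qpbar_alg_closure: "algebraic_closure (CR\<lparr>carrier := Qpbar\<rparr>) Qp"
    and Qpbar_dense: "closure Qpbar = UNIV"

definition value_group :: "('a::field \<Rightarrow> real) \<Rightarrow> 'a set \<Rightarrow> real set" where
  "value_group v L = v ` (L - {0})"

definition coset_space :: "real set \<Rightarrow> real set \<Rightarrow> real set set" where
  "coset_space G H = (\<lambda>g. (+) g ` H) ` G"

text \<open>
  The index \<open>[v(L\<^sup>*) : v(K\<^sup>*)]\<close>; when that index is infinite, the value is \<open>0\<close>.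
\<close>

definition ramification_index :: "('a::field \<Rightarrow> real) \<Rightarrow> 'a set \<Rightarrow> 'a set \<Rightarrow> nat" where
  "ramification_index v K L = card (coset_space (value_group v L) (value_group v K))"

text \<open>
  The subfield generated by \<open>Qp\<close> and \<open>t\<close> is \<open>Qp(t)\<close>, for algebraic and for transcendental \<open>t\<close>; the
  value group of \<open>Qp\<close> is \<open>\<int>\<close>.
\<close>

definition Cp_br :: "('a::field \<Rightarrow> real) \<Rightarrow> 'a set \<Rightarrow> 'a set" where
  "Cp_br v Qp = {t. finite (coset_space (value_group v (generate_field CR (insert t Qp))) \<int>)}"

definition finite_ext_in :: "'a::field set \<Rightarrow> 'a set \<Rightarrow> 'a set \<Rightarrow> bool" where
  "finite_ext_in \<Omega> K L \<longleftrightarrow>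
     subfield K CR \<and> subfield L CR \<and> K \<subseteq> L \<and> L \<subseteq> \<Omega> \<and> ring.finite_dimension CR K L"

text \<open>
  For \<open>K\<close> finite over \<open>Qp\<close> the residue field of \<open>K\<close> is finite, so residue extensions are separable
  and a finite extension \<open>L/K\<close> is unramified iff its ramification index is 1. The maximal
  unramified extension of \<open>K\<close> is the union of all such \<open>L\<close> inside \<open>Qpbar\<close>.
\<close>

definition unramified_ext_in ::
    "('a::field \<Rightarrow> real) \<Rightarrow> 'a set \<Rightarrow> 'a set \<Rightarrow> 'a set \<Rightarrow> bool" where
  "unramified_ext_in v \<Omega> K L \<longleftrightarrow> finite_ext_in \<Omega> K L \<and> ramification_index v K L = 1"

definition max_unramified_ext :: "('a::field \<Rightarrow> real) \<Rightarrow> 'a set \<Rightarrow> 'a set \<Rightarrow> 'a set" where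
  "max_unramified_ext v \<Omega> K = \<Union> {L. unramified_ext_in v \<Omega> K L}"

end

theory Submission
  imports Defs
begin

text \<open>
  Let \<open>L\<close> be the closure of \<open>Qp(t)\<close>: a complete, discretely valued field. The residue field of
  \<open>\<complex>\<^sub>p\<close> is algebraic over the prime field, so by Newton's method every nonzero residue of \<open>L\<close> is
  represented by a root of unity in \<open>L\<close>. Newton's method also yields a uniformizer \<open>\<pi>\<close> of \<open>L\<close> that is
  algebraic over \<open>Qp\<close>. Expanding elements of \<open>L\<close> in powers of \<open>\<pi>\<close> with these digits shows that
  \<open>M = L \<inter> Qpbar\<close> is dense in \<open>L\<close>, and \<open>M\<close> is unramified over \<open>K = Qp(\<pi>)\<close> because \<open>K\<close> already has
  the value group of \<open>L\<close>.
\<close>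

section \<open>Subfields\<close>

text \<open>The difficulty is to find algebraic elements inside \<open>L\<close>. Since
  \<open>t\<close> may be transcendental, an approximation of a uniformizer taken from the dense
  subfield \<open>Qpbar\<close> has the right norm but may lie outside \<open>L\<close>. Algebraic
  elements are therefore produced as roots, in the complete field \<open>L\<close>, of polynomials
  with algebraic coefficients. For units the polynomial is \<open>X^n - 1\<close> with
  \<open>n\<close> prime to \<open>p\<close>, whose derivative is a unit. For the uniformizer, the
  value group of \<open>M\<close> could a priori have some index \<open>e > 1\<close> in that of
  \<open>L\<close>, and when \<open>p\<close> divides \<open>e\<close> the derivative of a
  polynomial \<open>X^e - c\<close> is not even a unit multiple of \<open>X^(e-1)\<close>; its
  smallness has to be beaten by a better approximation. There is no circle: that approximation comes
  from the density of the polynomials in a possibly transcendental uniformizer with coefficients in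
  \<open>M\<close>, and the density of \<open>M\<close> itself follows only afterwards.\<close>

lemma CR_simps [simp]:
  "carrier CR = UNIV" "\<one>\<^bsub>CR\<^esub> = 1" "\<zero>\<^bsub>CR\<^esub> = 0" "x \<otimes>\<^bsub>CR\<^esub> y = x * y" "x \<oplus>\<^bsub>CR\<^esub> y = x + y"
  by (simp_all add: ring_of_type_algebra_def)

lemmas CR_field = field_from_type_algebra
lemmas CR_domain = field.axioms(1)[OF CR_field]
lemmas CR_cring = cring_from_type_algebra
lemmas CR_ring = ring_from_type_algebra

lemma CR_a_inv [simp]: "\<ominus>\<^bsub>CR\<^esub> x = - (x :: 'a::field)"
  using abelian_group.minus_equality[OF ring.is_abelian_group[OF CR_ring], of "- x" x] by simp

lemma CR_m_inv: "x \<noteq> 0 \<Longrightarrow> inv\<^bsub>CR\<^esub> x = inverse (x :: 'a::field)"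
  using comm_monoid.comm_inv_char[OF cring.axioms(2)[OF CR_cring], of x "inverse x"] by simp

lemma CR_nat_pow [simp]: "x [^]\<^bsub>CR\<^esub> (n::nat) = (x :: 'a::field) ^ n"
  by (induction n) (simp_all add: nat_pow_def mult.commute)

lemma subfield_CRI:
  fixes S :: "'a::field set"
  assumes "1 \<in> S" "\<And>x y. x \<in> S \<Longrightarrow> y \<in> S \<Longrightarrow> x + y \<in> S"
    "\<And>x y. x \<in> S \<Longrightarrow> y \<in> S \<Longrightarrow> x * y \<in> S" "\<And>x. x \<in> S \<Longrightarrow> - x \<in> S"
    "\<And>x. x \<in> S \<Longrightarrow> x \<noteq> 0 \<Longrightarrow> inverse x \<in> S"
  shows "subfield S CR"
proof (rule field.subfieldI'[OF CR_field])
  show "subring S CR"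
    by (rule ring.subringI[OF CR_ring]) (use assms in auto)
qed (use assms in \<open>auto simp: CR_m_inv\<close>)

lemma subfield_CR_closed:
  fixes S :: "'a::field set"
  assumes S: "subfield S CR"
  shows subfield_CR_0: "0 \<in> S" and subfield_CR_1: "1 \<in> S"
    and subfield_CR_add: "x \<in> S \<Longrightarrow> y \<in> S \<Longrightarrow> x + y \<in> S"
    and subfield_CR_mult: "x \<in> S \<Longrightarrow> y \<in> S \<Longrightarrow> x * y \<in> S"
    and subfield_CR_uminus: "x \<in> S \<Longrightarrow> - x \<in> S"
    and subfield_CR_diff: "x \<in> S \<Longrightarrow> y \<in> S \<Longrightarrow> x - y \<in> S"
    and subfield_CR_inverse: "x \<in> S \<Longrightarrow> inverse x \<in> S"
    and subfield_CR_divide: "x \<in> S \<Longrightarrow> y \<in> S \<Longrightarrow> x / y \<in> S"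
proof -
  note R = subringE[OF subfieldE(1)[OF S], simplified]
  show 0: "0 \<in> S" and 1: "1 \<in> S" using R by blast+
  show add: "x + y \<in> S" if "x \<in> S" "y \<in> S" for x y using R that by blast
  show mult: "x * y \<in> S" if "x \<in> S" "y \<in> S" for x y using R that by blast
  show minus: "- x \<in> S" if "x \<in> S" for x using R that by blast
  show inv: "inverse x \<in> S" if "x \<in> S" for x
    using ring.subfield_m_inv(1)[OF CR_ring S, of x] that 0 by (cases "x = 0") (auto simp: CR_m_inv)
  show "x - y \<in> S" if "x \<in> S" "y \<in> S" for x y
    using add[of x "- y"] minus that by simp
  show "x / y \<in> S" if "x \<in> S" "y \<in> S" for x y
    using mult[of x "inverse y"] inv that by (simp add: divide_inverse)
qed

lemma subfield_CR_power: "subfield S CR \<Longrightarrow> x \<in> S \<Longrightarrow> (x :: 'a::field) ^ n \<in> S"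
  by (induction n) (auto intro: subfield_CR_closed)

lemma subfield_CR_power_int: "subfield S CR \<Longrightarrow> x \<in> S \<Longrightarrow> (x :: 'a::field) powi n \<in> S"
  by (auto simp: power_int_def intro: subfield_CR_closed subfield_CR_power)

lemma subfield_CR_sum:
  "subfield S CR \<Longrightarrow> (\<And>i. i \<in> A \<Longrightarrow> f i \<in> S) \<Longrightarrow> (\<Sum>i\<in>A. f i :: 'a::field) \<in> S"
  by (induction A rule: infinite_finite_induct) (auto intro: subfield_CR_closed)

lemma subfield_CR_of_nat: "subfield S CR \<Longrightarrow> (of_nat n :: 'a::field) \<in> S"
  by (induction n) (auto intro: subfield_CR_closed)

lemma subfield_CR_poly:
  "subfield S CR \<Longrightarrow> (\<And>i. poly.coeff f i \<in> S) \<Longrightarrow> x \<in> S \<Longrightarrow> poly f (x :: 'a::field) \<in> S"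
  unfolding poly_altdef by (intro subfield_CR_sum subfield_CR_mult subfield_CR_power)

lemma subfield_CR_Int: "subfield S CR \<Longrightarrow> subfield T CR \<Longrightarrow> subfield (S \<inter> T :: 'a::field set) CR"
  by (rule subfield_CRI) (auto intro: subfield_CR_closed)

lemma poly_eq_sum_lessThan:
  fixes f :: "'a::comm_semiring_1 poly"
  assumes "\<And>i. i \<ge> n \<Longrightarrow> poly.coeff f i = 0"
  shows "poly f x = (\<Sum>i<n. poly.coeff f i * x ^ i)"
proof (cases "n = 0")
  case True
  hence "f = 0" using assms by (auto simp: poly_eq_iff)
  thus ?thesis using True by simp
next
  case False
  have "Polynomial.degree f \<le> n - 1"
    using False by (intro degree_le allI impI assms) auto
  thus ?thesis unfolding poly_altdef[of f]
    using False by (intro sum.mono_neutral_left) (auto simp: coeff_eq_0)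
qed

section \<open>Ultrametric fields\<close>

text \<open>A real-valued norm is used instead of \<open>v\<close> because it has a definite value
  at 0. Positivity, definiteness and symmetry are inherited from the metric through
  \<open>dist_eq_nrm\<close>.\<close>

locale ultranormed_field =
  fixes nrm :: "'a::{field, complete_space} \<Rightarrow> real"
  assumes dist_eq_nrm: "dist x y = nrm (x - y)"
    and nrm_mult: "nrm (x * y) = nrm x * nrm y"
    and nrm_add_le: "nrm (x + y) \<le> max (nrm x) (nrm y)"
begin

lemma nrm_eq_dist: "nrm x = dist x 0"
  using dist_eq_nrm[of x 0] by simp

lemma nrm_0 [simp]: "nrm 0 = 0"
  by (simp add: nrm_eq_dist)

lemma nrm_nonneg [simp]: "0 \<le> nrm x"
  by (simp add: nrm_eq_dist)

lemma nrm_eq_0_iff [simp]: "nrm x = 0 \<longleftrightarrow> x = 0"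
  by (simp add: nrm_eq_dist)

lemma nrm_pos_iff [simp]: "0 < nrm x \<longleftrightarrow> x \<noteq> 0"
  by (simp add: nrm_eq_dist)

lemma nrm_1 [simp]: "nrm 1 = 1"
  using nrm_mult[of 1 1] by simp

lemma nrm_minus_commute: "nrm (x - y) = nrm (y - x)"
  using dist_eq_nrm dist_commute by metis

lemma nrm_minus [simp]: "nrm (- x) = nrm x"
  using nrm_minus_commute[of 0 x] by simp

lemma nrm_diff_le: "nrm (x - y) \<le> max (nrm x) (nrm y)"
  using nrm_add_le[of x "- y"] by simp

lemma nrm_add_leI: "nrm x \<le> c \<Longrightarrow> nrm y \<le> c \<Longrightarrow> nrm (x + y) \<le> c"
  using nrm_add_le[of x y] by simp

lemma nrm_add_lessI: "nrm x < c \<Longrightarrow> nrm y < c \<Longrightarrow> nrm (x + y) < c"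
  using nrm_add_le[of x y] by simp

lemma nrm_diff_leI: "nrm x \<le> c \<Longrightarrow> nrm y \<le> c \<Longrightarrow> nrm (x - y) \<le> c"
  using nrm_diff_le[of x y] by simp

lemma nrm_diff_lessI: "nrm x < c \<Longrightarrow> nrm y < c \<Longrightarrow> nrm (x - y) < c"
  using nrm_diff_le[of x y] by simp

lemma nrm_trans_less: "nrm (x - y) < c \<Longrightarrow> nrm (y - z) < c \<Longrightarrow> nrm (x - z) < c"
  using nrm_add_lessI[of "x - y" c "y - z"] by simp

lemma nrm_power: "nrm (x ^ n) = nrm x ^ n"
  by (induction n) (auto simp: nrm_mult)

lemma nrm_inverse: "nrm (inverse x) = inverse (nrm x)"
proof (cases "x = 0")
  case False
  hence "nrm x * nrm (inverse x) = 1"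
    by (simp flip: nrm_mult)
  thus ?thesis by (simp add: inverse_unique)
qed simp

lemma nrm_divide: "nrm (x / y) = nrm x / nrm y"
  by (simp add: divide_inverse nrm_mult nrm_inverse)

lemma nrm_power_int: "nrm (x powi n) = nrm x powi n"
  by (auto simp: power_int_def nrm_power nrm_inverse)

text \<open>The isosceles triangle principle: in \<open>x = (x - y) + y\<close> and
  \<open>y = x - (x - y)\<close> the term \<open>x - y\<close> is too small to attain the
  maximum.\<close>

lemma nrm_eq_of_diff_less:
  assumes "nrm (x - y) < nrm x"
  shows "nrm y = nrm x"
  using nrm_add_le[of "x - y" y] nrm_diff_le[of x "x - y"] assms by auto

lemma nrm_sum_leI: "(\<And>i. i \<in> A \<Longrightarrow> nrm (f i) \<le> c) \<Longrightarrow> 0 \<le> c \<Longrightarrow> nrm (\<Sum>i\<in>A. f i) \<le> c"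
  by (induction A rule: infinite_finite_induct) (auto intro: nrm_add_leI)

lemma nrm_sum_lessI: "(\<And>i. i \<in> A \<Longrightarrow> nrm (f i) < c) \<Longrightarrow> 0 < c \<Longrightarrow> nrm (\<Sum>i\<in>A. f i) < c"
  by (induction A rule: infinite_finite_induct) (auto intro: nrm_add_lessI)

lemma nrm_of_nat_le_1: "nrm (of_nat n) \<le> 1"
  by (induction n) (auto intro: nrm_add_leI)

lemma nrm_of_int_le_1: "nrm (of_int n) \<le> 1"
  by (cases n rule: int_cases2) (auto simp: nrm_of_nat_le_1)

text \<open>Terms of pairwise distinct norms cannot cancel: exactly one of them dominates, and the
  sum has its norm. This later bounds coefficients from above and a derivative from below.\<close>

lemma nrm_le_sum_distinct:
  assumes "finite A" "i \<in> A"
    and distinct: "\<And>i j. i \<in> A \<Longrightarrow> j \<in> A \<Longrightarrow> f i \<noteq> 0 \<Longrightarrow> nrm (f i) = nrm (f j) \<Longrightarrow> i = j"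
  shows "nrm (f i) \<le> nrm (\<Sum>j\<in>A. f j)"
proof (cases "f i = 0")
  case False
  define N where "N = Max ((\<lambda>j. nrm (f j)) ` A)"
  have le: "nrm (f j) \<le> N" if "j \<in> A" for j
    unfolding N_def using assms(1) that by (intro Max_ge) auto
  have "N \<in> (\<lambda>j. nrm (f j)) ` A"
    unfolding N_def using assms(1,2) by (intro Max_in) auto
  then obtain k where k: "k \<in> A" "N = nrm (f k)" by auto
  have "nrm (f i) > 0" using False by simp
  hence N: "N > 0" using le[OF assms(2)] by linarith
  hence "f k \<noteq> 0" using k by auto
  have "nrm (\<Sum>j\<in>A - {k}. f j) < N"
  proof (rule nrm_sum_lessI)
    fix j assume "j \<in> A - {k}"
    thus "nrm (f j) < N" using le[of j] distinct[of k j] k \<open>f k \<noteq> 0\<close> by fastforce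
  qed fact
  hence "nrm (\<Sum>j\<in>A. f j) = nrm (f k)"
    using nrm_eq_of_diff_less[of "f k" "\<Sum>j\<in>A. f j"] k
    by (simp add: sum.remove[OF assms(1), of k] del: sum.remove)
  thus ?thesis using le[OF assms(2)] k by simp
qed simp

lemma closure_nrm: "x \<in> closure S \<longleftrightarrow> (\<forall>e>0. \<exists>y\<in>S. nrm (x - y) < e)"
  unfolding closure_approachable dist_eq_nrm by (metis nrm_minus_commute)

lemma subfield_closure:
  fixes S :: "'a set"
  assumes S: "subfield S CR"
  shows "subfield (closure S) CR"
proof (rule subfield_CRI)
  show "1 \<in> closure S"
    using subfield_CR_1[OF S] closure_subset by blast
next
  fix x y assume xy: "x \<in> closure S" "y \<in> closure S"
  show "x + y \<in> closure S"
    unfolding closure_nrm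
  proof (intro allI impI)
    fix e :: real assume "e > 0"
    then obtain x' y' where "x' \<in> S" "y' \<in> S" "nrm (x - x') < e" "nrm (y - y') < e"
      using xy unfolding closure_nrm by meson
    moreover from this have "nrm ((x - x') + (y - y')) < e" by (intro nrm_add_lessI)
    ultimately show "\<exists>z\<in>S. nrm (x + y - z) < e"
      by (intro bexI[of _ "x' + y'"]) (auto simp: algebra_simps intro: subfield_CR_add[OF S])
  qed
  show "x * y \<in> closure S"
    unfolding closure_nrm
  proof (intro allI impI)
    fix e :: real assume "e > 0"
    \<comment> \<open>The error splits as \<open>x * (y - y') + (x - x') * y'\<close>. The cap 1 in
      \<open>e1\<close> gives \<open>nrm y' \<le> nrm y + 1\<close>, which is the denominator of
      \<open>e2\<close>; adding 1 avoids division by zero.\<close>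
    define e1 where "e1 = min 1 (e / (nrm x + 1))"
    define e2 where "e2 = e / (nrm y + 1)"
    have pos: "nrm x + 1 > 0" "nrm y + 1 > 0" by (simp_all add: add_nonneg_pos)
    have "e1 > 0" "e2 > 0" using \<open>e > 0\<close> pos by (auto simp: e1_def e2_def)
    then obtain x' y' where *: "x' \<in> S" "y' \<in> S" "nrm (x - x') < e2" "nrm (y - y') < e1"
      using xy unfolding closure_nrm by meson
    have "nrm y' \<le> max (nrm y) (nrm (y - y'))"
      using nrm_diff_le[of y "y - y'"] by simp
    hence y': "nrm y' \<le> nrm y + 1" using *(4) nrm_nonneg[of y]
      by (simp add: e1_def max_def split: if_splits del: nrm_nonneg)
    have "nrm (x * (y - y')) < e"
    proof -
      have "nrm x * nrm (y - y') \<le> nrm x * (e / (nrm x + 1))"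
        using *(4) by (intro mult_left_mono) (auto simp: e1_def)
      also have "\<dots> < e" using pos \<open>e > 0\<close> by (simp add: field_simps)
      finally show ?thesis by (simp add: nrm_mult)
    qed
    moreover have "nrm ((x - x') * y') < e"
    proof -
      have "nrm (x - x') * nrm y' \<le> nrm (x - x') * (nrm y + 1)"
        using y' by (intro mult_left_mono) auto
      also have "\<dots> < e2 * (nrm y + 1)" using * pos by (intro mult_strict_right_mono) auto
      also have "\<dots> = e" using pos by (simp add: e2_def)
      finally show ?thesis by (simp add: nrm_mult)
    qed
    ultimately have "nrm (x * (y - y') + (x - x') * y') < e"
      by (intro nrm_add_lessI)
    thus "\<exists>z\<in>S. nrm (x * y - z) < e"
      using * by (intro bexI[of _ "x' * y'"]) (auto simp: algebra_simps intro: subfield_CR_mult[OF S])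
  qed
next
  fix x assume x: "x \<in> closure S"
  show "- x \<in> closure S"
    unfolding closure_nrm
  proof (intro allI impI)
    fix e :: real assume "e > 0"
    then obtain x' where "x' \<in> S" "nrm (x - x') < e"
      using x unfolding closure_nrm by meson
    thus "\<exists>z\<in>S. nrm (- x - z) < e"
      using nrm_minus_commute[of x' x] by (intro bexI[of _ "- x'"]) (auto intro: subfield_CR_uminus[OF S])
  qed
  show "inverse x \<in> closure S" if "x \<noteq> 0"
    unfolding closure_nrm
  proof (intro allI impI)
    fix e :: real assume "e > 0"
    \<comment> \<open>The first bound forces \<open>nrm x' = nrm x\<close>, so \<open>x'\<close> is
      nonzero; the second absorbs the denominator \<open>x * x'\<close> of the difference of the
      inverses.\<close>
    define d where "d = min (nrm x) (e * nrm x * nrm x)"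
    have "d > 0" using \<open>e > 0\<close> that by (simp add: d_def)
    then obtain x' where *: "x' \<in> S" "nrm (x - x') < d"
      using x unfolding closure_nrm by meson
    hence eq: "nrm x' = nrm x" by (intro nrm_eq_of_diff_less) (auto simp: d_def)
    hence "x' \<noteq> 0" using that by auto
    hence "inverse x - inverse x' = (x' - x) / (x * x')" using that by (simp add: field_simps)
    hence "nrm (inverse x - inverse x') = nrm (x - x') / (nrm x * nrm x)"
      by (simp add: nrm_divide nrm_mult eq nrm_minus_commute)
    also have "\<dots> < e"
      using * that by (simp add: d_def field_simps)
    finally show "\<exists>z\<in>S. nrm (inverse x - z) < e"
      using * by (intro bexI[of _ "inverse x'"]) (auto intro: subfield_CR_inverse[OF S])
  qed
qed

section \<open>Polynomials with integral coefficients and Newton's method\<close>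

lemma nrm_poly_le_1:
  "(\<And>i. nrm (poly.coeff g i) \<le> 1) \<Longrightarrow> nrm x \<le> 1 \<Longrightarrow> nrm (poly g x) \<le> 1"
  unfolding poly_altdef
  by (intro nrm_sum_leI) (auto simp: nrm_mult nrm_power intro!: mult_le_one power_le_one)

lemma nrm_coeff_pderiv_le_1:
  "(\<And>i. nrm (poly.coeff g i) \<le> 1) \<Longrightarrow> nrm (poly.coeff (pderiv g) i) \<le> 1"
  unfolding coeff_pderiv nrm_mult by (intro mult_le_one nrm_of_nat_le_1) auto

lemma nrm_poly_diff_le:
  assumes "\<And>i. nrm (poly.coeff g i) \<le> 1" "nrm x \<le> 1" "nrm y \<le> 1"
  shows "nrm (poly g x - poly g y) \<le> nrm (x - y)"
  using assms(1)
proof (induction g)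
  case (pCons c g)
  have co: "nrm (poly.coeff g i) \<le> 1" for i
    using pCons.prems[of "Suc i"] by simp
  have "poly (pCons c g) x - poly (pCons c g) y = x * (poly g x - poly g y) + (x - y) * poly g y"
    by (simp add: algebra_simps)
  also have "nrm \<dots> \<le> nrm (x - y)"
  proof (rule nrm_add_leI)
    show "nrm (x * (poly g x - poly g y)) \<le> nrm (x - y)"
      using mult_mono[OF assms(2) pCons.IH[OF co]] by (simp add: nrm_mult)
    show "nrm ((x - y) * poly g y) \<le> nrm (x - y)"
      using nrm_poly_le_1[of g y] co assms(3) by (simp add: nrm_mult mult_left_le)
  qed
  finally show ?case .
qed simp

text \<open>On the ball of radius \<open>e\<close> around \<open>a\<close>, the map \<open>g\<close>
  differs from its linear part with slope \<open>g' a\<close> by a map of Lipschitz constant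
  \<open>e\<close>. Induction along Horner's scheme avoids higher derivatives: each of the three
  terms of the recursion carries a factor bounded by \<open>e\<close>.\<close>

lemma nrm_taylor_le:
  assumes "\<And>i. nrm (poly.coeff g i) \<le> 1" "nrm x \<le> 1" "nrm y \<le> 1" "nrm a \<le> 1"
    and "nrm (x - a) \<le> e" "nrm (y - a) \<le> e"
  shows "nrm (poly g x - poly g y - poly (pderiv g) a * (x - y)) \<le> e * nrm (x - y)"
  using assms(1)
proof (induction g)
  case 0
  have "0 \<le> e" using assms(5) nrm_nonneg[of "x - a"] by linarith
  thus ?case by simp
next
  case (pCons c g)
  have e: "0 \<le> e" using assms(5) nrm_nonneg[of "x - a"] by linarith
  have co: "nrm (poly.coeff g i) \<le> 1" for i
    using pCons.prems[of "Suc i"] by simp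
  have "poly (pCons c g) x - poly (pCons c g) y - poly (pderiv (pCons c g)) a * (x - y)
      = x * (poly g x - poly g y - poly (pderiv g) a * (x - y))
        + ((poly g y - poly g a) * (x - y) + ((x - a) * poly (pderiv g) a) * (x - y))"
    by (simp add: pderiv_pCons algebra_simps)
  also have "nrm \<dots> \<le> e * nrm (x - y)"
  proof (intro nrm_add_leI)
    show "nrm (x * (poly g x - poly g y - poly (pderiv g) a * (x - y))) \<le> e * nrm (x - y)"
      using mult_mono[OF assms(2) pCons.IH[OF co]] by (simp add: nrm_mult)
    have "nrm (poly g y - poly g a) \<le> e"
      using nrm_poly_diff_le[of g y a] co assms by force
    thus "nrm ((poly g y - poly g a) * (x - y)) \<le> e * nrm (x - y)"
      by (simp add: nrm_mult mult_right_mono)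
    have "nrm (poly (pderiv g) a) \<le> 1"
      by (intro nrm_poly_le_1 nrm_coeff_pderiv_le_1 co assms)
    hence "nrm (x - a) * nrm (poly (pderiv g) a) \<le> e * 1"
      using assms(5) e by (intro mult_mono) auto
    thus "nrm ((x - a) * poly (pderiv g) a * (x - y)) \<le> e * nrm (x - y)"
      by (simp add: nrm_mult mult_right_mono)
  qed
  finally show ?case .
qed

text \<open>Newton's method with frozen derivative, \<open>x \<mapsto> x - g x / g' a\<close>, is a contraction near \<open>a\<close>.\<close>

lemma newton_root:
  assumes L: "subfield L CR" "closed L" and a: "a \<in> L" "nrm a \<le> 1"
    and co: "\<And>i. poly.coeff g i \<in> L" "\<And>i. nrm (poly.coeff g i) \<le> 1"
    and e: "0 \<le> e" "e < nrm (poly (pderiv g) a)" "nrm (poly g a) \<le> e * nrm (poly (pderiv g) a)"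
  obtains b where "b \<in> L" "poly g b = 0" "nrm (b - a) \<le> e"
proof -
  define D where "D = poly (pderiv g) a"
  have D: "nrm D > 0" "D \<in> L" "nrm D \<le> 1"
    unfolding D_def using e co a
    by (linarith, auto intro!: subfield_CR_poly[OF L(1)] nrm_poly_le_1 nrm_coeff_pderiv_le_1
        subfield_CR_mult[OF L(1)] subfield_CR_of_nat[OF L(1)] simp: coeff_pderiv simp del: of_nat_Suc)
  hence D0: "D \<noteq> 0" by auto
  define T where "T x = x - poly g x / D" for x
  \<comment> \<open>Intersecting the ball with the closed subfield \<open>L\<close> keeps the search
    space complete and places the fixed point in \<open>L\<close>.\<close>
  define B where "B = L \<inter> {x. nrm (x - a) \<le> e}"
  have B_alt: "B = L \<inter> cball a e"
    by (auto simp: B_def dist_eq_nrm nrm_minus_commute)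
  have "a \<in> B" using a e by (auto simp: B_def)
  have int: "nrm x \<le> 1" if "x \<in> B" for x
    using that nrm_add_leI[of "x - a" 1 a] a e D by (auto simp: B_def D_def)
  have lip: "nrm (T x - T y) \<le> e / nrm D * nrm (x - y)" if "x \<in> B" "y \<in> B" for x y
  proof -
    have "T x - T y = - (poly g x - poly g y - D * (x - y)) / D"
      using D0 by (simp add: T_def field_simps)
    hence "nrm (T x - T y) = nrm (poly g x - poly g y - D * (x - y)) / nrm D"
      by (simp add: nrm_divide nrm_minus_commute)
    also have "\<dots> \<le> e * nrm (x - y) / nrm D"
      unfolding D_def using that
      by (intro divide_right_mono nrm_taylor_le co int a) (auto simp: B_def)
    finally show ?thesis by simp
  qed
  \<comment> \<open>The bound \<open>e < nrm D\<close> makes \<open>T\<close> a contraction, and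
    \<open>nrm (poly g a) \<le> e * nrm D\<close> bounds the first step \<open>T a - a\<close> by
    \<open>e\<close>, so \<open>T\<close> maps \<open>B\<close> into itself.\<close>
  have "\<exists>!x\<in>B. T x = x"
  proof (rule Banach_fix)
    show "complete B" unfolding B_alt using L(2) by (simp add: complete_eq_closed closed_Int)
    show "B \<noteq> {}" using \<open>a \<in> B\<close> by auto
    show "0 \<le> e / nrm D" "e / nrm D < 1" using D e by (auto simp: D_def)
    show "dist (T x) (T y) \<le> e / nrm D * dist x y" if "x \<in> B" "y \<in> B" for x y
      using lip[OF that] by (simp add: dist_eq_nrm)
    show "T ` B \<subseteq> B"
    proof (rule image_subsetI)
      fix x assume x: "x \<in> B"
      have "T x - a = (T x - T a) + (- (poly g a / D))" by (simp add: T_def)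
      also have "nrm \<dots> \<le> e"
      proof (rule nrm_add_leI)
        have "nrm (T x - T a) \<le> e / nrm D * nrm (x - a)" using lip x \<open>a \<in> B\<close> by blast
        also have "\<dots> \<le> 1 * e"
          using x D e by (intro mult_mono) (auto simp: D_def B_def)
        finally show "nrm (T x - T a) \<le> e" by simp
        show "nrm (- (poly g a / D)) \<le> e"
          using e D by (simp add: nrm_divide D_def field_simps)
      qed
      finally show "T x \<in> B"
        using x D co by (auto simp: B_def T_def intro!: subfield_CR_closed[OF L(1)] subfield_CR_poly[OF L(1)])
    qed
  qed
  then obtain b where b: "b \<in> B" "T b = b" by auto
  hence "poly g b = 0" using D0 by (simp add: T_def)
  thus ?thesis using that b by (auto simp: B_def)
qed

text \<open>Norms on \<open>L\<close> are discrete, so a strict decrease of the error is a decrease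
  by at least the factor \<open>\<rho>\<close>, and repeated correction converges geometrically.
  Only additive closure of \<open>S\<close> is required, so that \<open>S\<close> may be a span of
  powers as well as a field.\<close>

lemma dense_if_approx:
  assumes rho: "0 < \<rho>" "\<rho> < 1" "\<And>x. x \<in> L \<Longrightarrow> x \<noteq> 0 \<Longrightarrow> \<exists>k::int. nrm x = \<rho> powi k"
    and L: "subfield L CR" and S: "S \<subseteq> L" "0 \<in> S" "\<And>x y. x \<in> S \<Longrightarrow> y \<in> S \<Longrightarrow> x + y \<in> S"
    and step: "\<And>x. x \<in> L \<Longrightarrow> x \<noteq> 0 \<Longrightarrow> \<exists>y\<in>S. nrm (x - y) < nrm x"
    and "x \<in> L"
  shows "x \<in> closure S"
proof -
  have *: "\<exists>y\<in>S. nrm (x - y) \<le> \<rho> ^ n * nrm x" for n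
  proof (induction n)
    case 0
    show ?case using S(2) by (intro bexI[of _ 0]) auto
  next
    case (Suc n)
    then obtain y where y: "y \<in> S" "nrm (x - y) \<le> \<rho> ^ n * nrm x" by blast
    show ?case
    proof (cases "x = y")
      case True
      thus ?thesis using y rho by (intro bexI[of _ y]) auto
    next
      case False
      have z: "x - y \<in> L" using \<open>x \<in> L\<close> y S(1) by (auto intro: subfield_CR_diff[OF L])
      obtain y' where y': "y' \<in> S" "nrm (x - y - y') < nrm (x - y)"
        using step[OF z] False by auto
      have "nrm (x - y - y') \<le> \<rho> * nrm (x - y)"
      proof (cases "x - y - y' = 0")
        case False
        have "x - y - y' \<in> L" using z y' S(1) by (auto intro: subfield_CR_diff[OF L])
        then obtain i j :: int where ij: "nrm (x - y) = \<rho> powi i" "nrm (x - y - y') = \<rho> powi j"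
          using rho(3) z False \<open>x \<noteq> y\<close> by (metis right_minus_eq)
        \<comment> \<open>Powers of \<open>\<rho> < 1\<close> decrease, so the smaller norm has the
          larger exponent, and for integers this means \<open>j \<ge> i + 1\<close>.\<close>
        have "\<not> j \<le> i"
          using y'(2) rho power_int_decreasing[of j i \<rho>] unfolding ij by auto
        hence "\<rho> powi j \<le> \<rho> powi (i + 1)" using rho by (intro power_int_decreasing) auto
        thus ?thesis using rho unfolding ij by (simp add: power_int_add mult.commute)
      qed (use rho in \<open>simp del: right_minus_eq\<close>)
      also have "\<dots> \<le> \<rho> * (\<rho> ^ n * nrm x)"
        using y rho by (intro mult_left_mono) auto
      finally show ?thesis
        using y y' S(3) by (intro bexI[of _ "y + y'"]) (auto simp: algebra_simps)
    qed
  qed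
  show ?thesis unfolding closure_nrm
  proof (intro allI impI)
    fix e :: real assume "e > 0"
    have "nrm x + 1 > 0" by (simp add: add_nonneg_pos)
    then obtain n where n: "\<rho> ^ n < e / (nrm x + 1)"
      using real_arch_pow_inv[of "e / (nrm x + 1)" \<rho>] rho \<open>e > 0\<close> by auto
    obtain y where y: "y \<in> S" "nrm (x - y) \<le> \<rho> ^ n * nrm x" using * by blast
    have "\<rho> ^ n * nrm x \<le> \<rho> ^ n * (nrm x + 1)" using rho by (intro mult_left_mono) auto
    also have "\<dots> < e" using n \<open>nrm x + 1 > 0\<close> by (simp add: field_simps)
    finally show "\<exists>y\<in>S. nrm (x - y) < e" using y by force
  qed
qed

end

section \<open>Algebraic elements\<close>

text \<open>The list polynomials of \<open>ring.eval\<close> start with the leading coefficient,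
  those of \<open>Poly\<close> with the constant one; hence the reversal.\<close>

lemma CR_eval: "ring.eval CR p x = poly (Poly (rev p)) (x :: 'a::field)"
proof (induction p)
  case Nil
  show ?case by (simp add: ring.eval.simps[OF CR_ring])
next
  case (Cons a p)
  have "poly (Poly (rev p @ [a])) x = poly (Poly (rev p)) x + a * x ^ length p"
    by (simp add: Poly_append poly_monom)
  thus ?case by (simp add: ring.eval.simps[OF CR_ring] Cons.IH)
qed

lemma CR_algebraicE:
  fixes x :: "'a::field"
  assumes "ring.algebraic CR K x" "subfield K CR"
  obtains f where "f \<noteq> 0" "\<forall>i. poly.coeff f i \<in> K" "poly f x = 0"
proof -
  obtain p where p: "p \<in> carrier (K[X]\<^bsub>CR\<^esub>)" "p \<noteq> []" "ring.eval CR p x = \<zero>\<^bsub>CR\<^esub>"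
    using domain.algebraicE[OF CR_domain subfieldE(1)[OF assms(2)], of x, unfolded over_def] assms(1)
    by auto
  hence P: "set p \<subseteq> K" "hd p \<noteq> 0"
    by (auto simp: polynomial_def simp flip: univ_poly_carrier)
  have co: "poly.coeff (Poly (rev p)) i \<in> K" for i
    using P subfield_CR_0[OF assms(2)] by (auto simp: nth_default_def rev_nth intro!: subsetD[OF P(1)])
  have "poly.coeff (Poly (rev p)) (length p - 1) = hd p"
    using p(2) by (simp add: nth_default_def rev_nth hd_conv_nth)
  hence "Poly (rev p) \<noteq> 0" using P(2) by force
  thus ?thesis using that co p(3) by (simp add: CR_eval)
qed

section \<open>The p-adic norm\<close>

context padic_complex_field
begin

definition pnorm :: "'a \<Rightarrow> real" where
  "pnorm x = (if x = 0 then 0 else real p powr - v x)"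

lemma p_gt_1: "real p > 1"
  using prime_gt_1_nat[OF prime_p] by simp

sublocale ultranormed_field pnorm
proof
  fix x y :: 'a
  show "dist x y = pnorm (x - y)" by (simp add: val_dist pnorm_def)
  show "pnorm (x * y) = pnorm x * pnorm y"
    by (auto simp: pnorm_def val_mult powr_add[symmetric])
  show "pnorm (x + y) \<le> max (pnorm x) (pnorm y)"
  proof (cases "x = 0 \<or> y = 0 \<or> x + y = 0")
    case False
    hence "min (v x) (v y) \<le> v (x + y)" using val_add by blast
    hence "real p powr - v (x + y) \<le> max (real p powr - v x) (real p powr - v y)"
      using p_gt_1 by (auto simp: min_def max_def split: if_splits)
    thus ?thesis using False by (simp add: pnorm_def)
  qed (auto simp: pnorm_def le_max_iff_disj)
qed

lemma pnorm_eq_iff: "x \<noteq> 0 \<Longrightarrow> y \<noteq> 0 \<Longrightarrow> pnorm x = pnorm y \<longleftrightarrow> v x = v y"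
  using p_gt_1 powr_inj[of "real p" "- v x" "- v y"] by (auto simp: pnorm_def)

lemma pnorm_p_less_1: "pnorm (of_nat p) < 1"
proof -
  have "v (of_int (int p)) = 1"
    using prime_p by (subst val_of_int) (auto simp: prime_gt_0_nat)
  thus ?thesis using p_gt_1 by (simp add: pnorm_def powr_minus field_simps)
qed

lemma pnorm_of_int_eq_1: "\<not> int p dvd n \<Longrightarrow> pnorm (of_int n) = 1"
  using val_of_int[of n] p_gt_1 by (auto simp: pnorm_def not_dvd_imp_multiplicity_0)

lemma pnorm_of_nat_eq_1: "\<not> p dvd n \<Longrightarrow> pnorm (of_nat n) = 1"
  using pnorm_of_int_eq_1[of "int n"] by simp

lemma pnorm_of_int_less_1: "int p dvd n \<Longrightarrow> pnorm (of_int n) < 1"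
proof (elim dvdE)
  fix k assume "n = int p * k"
  hence "pnorm (of_int n) = pnorm (of_nat p) * pnorm (of_int k)" by (simp add: nrm_mult)
  also have "\<dots> \<le> pnorm (of_nat p) * 1" by (intro mult_left_mono nrm_of_int_le_1) auto
  finally show ?thesis using pnorm_p_less_1 by simp
qed

lemma subfield_range_of_rat: "subfield (range (of_rat :: rat \<Rightarrow> 'a)) CR"
proof (rule subfield_CRI)
  show "1 \<in> range (of_rat :: rat \<Rightarrow> 'a)" by (metis of_rat_1 rangeI)
qed (auto simp flip: of_rat_add of_rat_mult of_rat_minus of_rat_inverse)

lemma subfield_Qp: "subfield Qp CR"
  unfolding Qp_closure by (intro subfield_closure subfield_range_of_rat)

lemma Qp_subset_Qpbar: "Qp \<subseteq> Qpbar"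
proof -
  interpret algebraic_closure "CR\<lparr>carrier := Qpbar\<rparr>" Qp by (rule Qpbar_alg_closure)
  show ?thesis using subfieldE(3)[OF subfield_axioms] by simp
qed

lemma algebraic_Qpbar:
  assumes "x \<in> Qpbar"
  shows "ring.algebraic CR Qp x"
proof -
  interpret algebraic_closure "CR\<lparr>carrier := Qpbar\<rparr>" Qp by (rule Qpbar_alg_closure)
  have "ring.algebraic (CR\<lparr>carrier := Qpbar\<rparr>) Qp x"
    using algebraic_extension[of x] assms by (simp add: over_def)
  thus ?thesis
    using ring.algebraic_consistent[OF CR_ring subfieldE(1)[OF subfield_Qpbar]] by metis
qed

lemma Qpbar_ex_root:
  assumes "\<And>i. poly.coeff f i \<in> Qpbar" "Polynomial.degree f > 0"
  obtains a where "a \<in> Qpbar" "poly f a = 0"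
proof -
  interpret AC: algebraic_closure "CR\<lparr>carrier := Qpbar\<rparr>" Qp by (rule Qpbar_alg_closure)
  let ?P = "rev (coeffs f)"
  have f: "f \<noteq> 0" using assms(2) by auto
  have P: "?P \<in> carrier (poly_ring (CR\<lparr>carrier := Qpbar\<rparr>))"
    using assms(1) f by (auto simp: polynomial_def coeffs_def hd_rev simp flip: univ_poly_carrier)
  hence "size (AC.roots ?P) = Polynomial.degree f"
    using AC.roots_over_carrier[OF P] f by (simp add: AC.splitted_def length_coeffs)
  hence "AC.roots ?P \<noteq> {#}" using assms(2) by auto
  then obtain a where "a \<in># AC.roots ?P" by blast
  hence "a \<in> Qpbar" "AC.eval ?P a = 0"
    using AC.roots_mem_iff_is_root[OF P] by (auto simp: AC.is_root_def)
  moreover have "AC.eval = ring.eval CR"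
    using ring.eval_consistent[OF CR_ring subfieldE(1)[OF subfield_Qpbar]] by metis
  ultimately show ?thesis using that by (simp add: CR_eval)
qed

text \<open>An algebraically closed field acquires no new roots in a larger field: after splitting
  off a root \<open>a\<close> from \<open>Qpbar\<close>, either \<open>x = a\<close> or
  \<open>x\<close> is a root of the quotient, which has smaller degree.\<close>

lemma Qpbar_root_closed:
  assumes "f \<noteq> 0" "\<And>i. poly.coeff f i \<in> Qpbar" "poly f x = 0"
  shows "x \<in> Qpbar"
  using assms
proof (induction "Polynomial.degree f" arbitrary: f rule: less_induct)
  case less
  show ?case
  proof (cases "Polynomial.degree f = 0")
    case True
    then obtain c where "f = [:c:]" by (rule degree_eq_zeroE)
    thus ?thesis using less.prems by simp
  next
    case False
    then obtain a where a: "a \<in> Qpbar" "poly f a = 0"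
      using Qpbar_ex_root[of f] less.prems by blast
    define q where "q = synthetic_div f a"
    have f: "f = [:- a, 1:] * q"
      using synthetic_div_correct'[of a f] a by (simp add: q_def)
    hence q0: "q \<noteq> 0" using less.prems by auto
    hence deg: "Polynomial.degree f = Suc (Polynomial.degree q)"
      unfolding f by (subst degree_mult_eq) auto
    have q: "poly.coeff q i \<in> Qpbar" for i
    proof (cases "i \<le> Polynomial.degree q")
      case True
      \<comment> \<open>Comparing coefficients in \<open>f = (X - a) * q\<close> determines those of
        \<open>q\<close> from the leading one downwards.\<close>
      thus ?thesis
      proof (induction i rule: inc_induct)
        case base
        have "poly.coeff f (Suc (Polynomial.degree q)) = poly.coeff q (Polynomial.degree q)"
          by (simp add: f coeff_eq_0)
        thus ?case using less.prems(2) by metis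
      next
        case (step n)
        have "poly.coeff f (Suc n) = poly.coeff q n - a * poly.coeff q (Suc n)"
          by (simp add: f)
        hence "poly.coeff q n = poly.coeff f (Suc n) + a * poly.coeff q (Suc n)" by simp
        thus ?case using step a less.prems(2) by (auto intro!: subfield_CR_closed[OF subfield_Qpbar])
      qed
    qed (auto simp: coeff_eq_0 subfield_CR_0[OF subfield_Qpbar])
    have "x = a \<or> poly q x = 0" using less.prems(3) unfolding f by auto
    thus ?thesis using less.hyps[of q] a q q0 deg by auto
  qed
qed

section \<open>Residues are roots of unity\<close>

text \<open>The residue field of \<open>Qp\<close> is the prime field. A rational
  \<open>a / b\<close> close to \<open>x\<close> is integral, so \<open>p\<close> does not divide
  \<open>b\<close>, and a Bezout inverse \<open>u\<close> of \<open>b\<close> modulo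
  \<open>p\<close> turns \<open>a / b\<close> into the integer \<open>a * u\<close>.\<close>

lemma Qp_integer_approx:
  assumes "x \<in> Qp" "pnorm x \<le> 1"
  obtains n :: int where "pnorm (x - of_int n) < 1"
proof -
  obtain r :: rat where r: "pnorm (x - of_rat r) < 1"
    using assms(1) unfolding Qp_closure closure_nrm by (metis (no_types) rangeE zero_less_one)
  have r1: "pnorm (of_rat r) \<le> 1"
    using nrm_diff_leI[of x 1 "x - of_rat r"] assms r by simp
  obtain a b where ab: "quotient_of r = (a, b)" by force
  hence b: "b > 0" "coprime a b" "(of_rat r :: 'a) = of_int a / of_int b"
    using quotient_of_denom_pos quotient_of_coprime quotient_of_div[OF ab] by (auto simp: of_rat_divide)
  have "\<not> int p dvd b"
  proof
    assume p: "int p dvd b"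
    hence "\<not> int p dvd a"
      using b(2) prime_p by (metis coprime_common_divisor not_prime_unit prime_nat_int_transfer)
    hence "pnorm (of_rat r) = 1 / pnorm (of_int b)"
      by (simp add: b nrm_divide pnorm_of_int_eq_1)
    moreover have "pnorm (of_int b) > 0" using b by simp
    ultimately show False
      using r1 pnorm_of_int_less_1[OF p] by (simp add: field_simps del: nrm_pos_iff)
  qed
  hence "coprime b (int p)"
    using prime_imp_coprime[of "int p" b] prime_p by (simp add: coprime_commute)
  then obtain u w where uw: "u * b + w * int p = 1"
    using bezout_int[of b "int p"] by auto
  have "of_int (u * b + w * int p) = (1 :: 'a)" by (simp only: uw of_int_1)
  hence uw': "1 - of_int u * of_int b = (of_int w * of_nat p :: 'a)" by (simp add: algebra_simps)
  have "of_rat r - of_int (a * u) = (of_rat r * (1 - of_int u * of_int b) :: 'a)"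
    using b(1) by (simp add: b(3) field_simps)
  also have "pnorm \<dots> = pnorm (of_rat r) * pnorm (of_int w) * pnorm (of_nat p)"
    by (simp add: uw' nrm_mult)
  also have "\<dots> \<le> 1 * 1 * pnorm (of_nat p)"
    using r1 by (intro mult_right_mono mult_mono nrm_of_int_le_1) auto
  finally have "pnorm (of_rat r - of_int (a * u)) < 1" using pnorm_p_less_1 by simp
  with r have "pnorm (x - of_int (a * u)) < 1" by (rule nrm_trans_less)
  thus ?thesis by (rule that)
qed

text \<open>The residue of \<open>a\<close> is algebraic over the prime field: a polynomial relation
  over \<open>Qp\<close> is scaled until its reduction is monic, and its coefficients are then
  replaced by integers.\<close>

lemma Qpbar_integer_relation:
  assumes "a \<in> Qpbar" "pnorm a \<le> 1"
  obtains d :: nat and n :: "nat \<Rightarrow> int" where "pnorm (a ^ d + (\<Sum>i<d. of_int (n i) * a ^ i)) < 1"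
proof -
  obtain f where f: "f \<noteq> 0" "\<forall>i. poly.coeff f i \<in> Qp" "poly f a = 0"
    by (rule CR_algebraicE[OF algebraic_Qpbar[OF assms(1)] subfield_Qp])
  define N where "N = Polynomial.degree f"
  define m where "m = Max ((\<lambda>i. pnorm (poly.coeff f i)) ` {..N})"
  define A where "A = {i\<in>{..N}. pnorm (poly.coeff f i) = m}"
  have le: "pnorm (poly.coeff f i) \<le> m" if "i \<le> N" for i
    unfolding m_def using that by (intro Max_ge) auto
  have "m \<in> (\<lambda>i. pnorm (poly.coeff f i)) ` {..N}"
    unfolding m_def by (intro Max_in) auto
  hence A: "finite A" "A \<noteq> {}" by (auto simp: A_def)
  \<comment> \<open>The last index at which the coefficient norm is maximal. After division by this
    coefficient everything beyond \<open>d\<close> has norm below 1 and disappears in the residue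
    field.\<close>
  define d where "d = Max A"
  have "d \<in> A" unfolding d_def using A by (rule Max_in)
  hence d: "d \<le> N" "pnorm (poly.coeff f d) = m" by (auto simp: A_def)
  have gt: "pnorm (poly.coeff f i) < m" if "i \<le> N" "d < i" for i
  proof (rule ccontr)
    assume "\<not> pnorm (poly.coeff f i) < m"
    hence "i \<in> A" using le[OF that(1)] that(1) by (simp add: A_def)
    thus False using Max_ge[OF A(1), of i] that(2) by (simp add: d_def)
  qed
  have "pnorm (poly.coeff f N) > 0" using f(1) by (simp add: N_def)
  hence m: "m > 0" using le[of N] by linarith
  define g where "g i = poly.coeff f i / poly.coeff f d" for i
  have g: "g i \<in> Qp" "i \<le> N \<Longrightarrow> pnorm (g i) \<le> 1" "i \<le> N \<Longrightarrow> d < i \<Longrightarrow> pnorm (g i) < 1" for i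
    using f(2) le gt m d(2) by (auto simp: g_def nrm_divide intro: subfield_CR_divide[OF subfield_Qp])
  have g_d: "g d = 1" using d(2) m by (auto simp: g_def)
  have "\<exists>n::int. pnorm (g i - of_int n) < 1" if "i \<le> N" for i
    using Qp_integer_approx[OF g(1) g(2)[OF that]] by blast
  then obtain n :: "nat \<Rightarrow> int" where n: "\<And>i. i \<le> N \<Longrightarrow> pnorm (g i - of_int (n i)) < 1"
    by metis
  \<comment> \<open>The part of \<open>g\<close> that is negligible in the residue field: rounding
    errors below \<open>d\<close>, nothing at \<open>d\<close>, the whole coefficient above
    \<open>d\<close>.\<close>
  define h where "h i = (if i < d then g i - of_int (n i) else if i = d then 0 else g i)" for i
  have "(\<Sum>i\<le>N. g i * a ^ i) = poly f a / poly.coeff f d"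
    unfolding poly_altdef N_def by (simp add: g_def sum_divide_distrib)
  hence g_sum: "(\<Sum>i\<le>N. g i * a ^ i) = 0" using f(3) by simp
  have "a ^ d + (\<Sum>i<d. of_int (n i) * a ^ i) = (\<Sum>i\<le>d. (g i - h i) * a ^ i)"
    by (simp add: h_def g_d flip: lessThan_Suc_atMost)
  also have "\<dots> = (\<Sum>i\<le>N. (g i - h i) * a ^ i)"
    using d(1) by (intro sum.mono_neutral_left) (auto simp: h_def)
  also have "\<dots> = - (\<Sum>i\<le>N. h i * a ^ i)"
    using g_sum by (simp add: left_diff_distrib sum_subtractf)
  also have "pnorm \<dots> < 1"
    unfolding nrm_minus
  proof (rule nrm_sum_lessI)
    fix i assume "i \<in> {..N}"
    hence "pnorm (h i) < 1" using n[of i] g(3)[of i] by (auto simp: h_def)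
    moreover have "pnorm (a ^ i) \<le> 1" using assms(2) by (simp add: nrm_power power_le_one)
    ultimately show "pnorm (h i * a ^ i) < 1"
      using mult_left_le[of "pnorm (a ^ i)" "pnorm (h i)"] by (simp add: nrm_mult)
  qed simp
  finally show ?thesis by (rule that)
qed

text \<open>By the relation, residues of powers of \<open>a\<close> are combinations of finitely
  many powers with coefficients from \<open>p\<close> classes. By pigeonhole two powers have the
  same residue, and the unit \<open>a ^ j\<close> can be divided out.\<close>

lemma Qpbar_residue_torsion:
  assumes "a \<in> Qpbar" "pnorm a = 1"
  obtains n :: nat where "n > 0" "pnorm (a ^ n - 1) < 1"
proof -
  obtain d and n :: "nat \<Rightarrow> int" where rel: "pnorm (a ^ d + (\<Sum>i<d. of_int (n i) * a ^ i)) < 1"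
    using Qpbar_integer_relation[of a] assms by auto
  define s where "s c = (\<Sum>i<d. of_int (c i) * a ^ i)" for c :: "nat \<Rightarrow> int"
  have d: "d \<noteq> 0" using rel by (intro notI) simp
  have "\<exists>c. pnorm (a ^ k - s c) < 1" for k
  proof (induction k)
    case 0
    have "s (\<lambda>i. if i = 0 then 1 else 0) = (\<Sum>i<d. if i = 0 then 1 else 0)"
      unfolding s_def by (intro sum.cong) auto
    hence "s (\<lambda>i. if i = 0 then 1 else 0) = 1" using d by simp
    thus ?case by (intro exI[of _ "\<lambda>i. if i = 0 then 1 else 0"]) simp
  next
    case (Suc k)
    then obtain c where c: "pnorm (a ^ k - s c) < 1" by blast
    obtain e where e: "d = Suc e" using d by (cases d) auto
    \<comment> \<open>Multiplication by \<open>a\<close>: the coefficients shift by one, and the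
      overflow \<open>c e * a ^ d\<close> is rewritten with the relation.\<close>
    define c' where "c' i = (if i = 0 then 0 else c (i - 1)) - c e * n i" for i
    have "(\<Sum>i<d. of_int (if i = 0 then 0 else c (i - 1)) * a ^ i) = (\<Sum>i<e. of_int (c i) * a ^ Suc i)"
      unfolding e by (subst sum.lessThan_Suc_shift) simp
    also have "\<dots> = a * s c - of_int (c e) * a ^ d"
      by (simp add: s_def e sum_distrib_left algebra_simps)
    finally have "s c' = a * s c - of_int (c e) * a ^ d - of_int (c e) * (\<Sum>i<d. of_int (n i) * a ^ i)"
      by (simp add: s_def c'_def left_diff_distrib sum_subtractf sum_distrib_left mult.assoc)
    hence "a ^ Suc k - s c' = a * (a ^ k - s c) + of_int (c e) * (a ^ d + (\<Sum>i<d. of_int (n i) * a ^ i))"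
      by (simp add: algebra_simps)
    also have "pnorm \<dots> < 1"
    proof (rule nrm_add_lessI)
      show "pnorm (a * (a ^ k - s c)) < 1" using c assms by (simp add: nrm_mult)
      show "pnorm (of_int (c e) * (a ^ d + (\<Sum>i<d. of_int (n i) * a ^ i))) < 1"
        unfolding nrm_mult
        using mult_right_mono[OF nrm_of_int_le_1[of "c e"] nrm_nonneg,
          of "a ^ d + (\<Sum>i<d. of_int (n i) * a ^ i)"] rel
        by linarith
    qed
    finally show ?case by blast
  qed
  then obtain c where c: "\<And>k. pnorm (a ^ k - s (c k)) < 1" by metis
  \<comment> \<open>Restricting the function to indices below \<open>d\<close> makes the set of
    reduced coefficient vectors finite.\<close>
  define r where "r k = (\<lambda>i\<in>{..<d}. c k i mod int p)" for k
  have r: "pnorm (a ^ k - s (r k)) < 1" for k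
  proof -
    have "s (c k) - s (r k) = (\<Sum>i<d. of_int (c k i - c k i mod int p) * a ^ i)"
      by (simp add: s_def r_def left_diff_distrib sum_subtractf)
    also have "pnorm \<dots> < 1"
      using assms by (intro nrm_sum_lessI)
        (auto simp: nrm_mult nrm_power simp del: of_int_diff intro!: pnorm_of_int_less_1)
    finally show ?thesis using c nrm_trans_less by blast
  qed
  have "range r \<subseteq> (\<Pi>\<^sub>E i\<in>{..<d}. {0..<int p})"
    using prime_gt_0_nat[OF prime_p] by (auto simp: r_def PiE_iff extensional_def split: if_splits)
  hence "finite (range r)" by (rule finite_subset) (intro finite_PiE; simp)
  hence "\<not> inj r" using range_inj_infinite by blast
  then obtain j k where jk: "j < k" "r j = r k"
    unfolding inj_def by (metis linorder_neqE_nat)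
  have "pnorm (a ^ k - a ^ j) < 1"
    using nrm_trans_less[OF r[of k], of "a ^ j"] r[of j] jk(2) nrm_minus_commute by metis
  also have "a ^ k - a ^ j = a ^ j * (a ^ (k - j) - 1)"
    using jk(1) by (simp add: right_diff_distrib flip: power_add)
  finally show ?thesis
    using jk(1) assms(2) by (intro that[of "k - j"]) (auto simp: nrm_mult nrm_power)
qed

text \<open>Frobenius is injective on residues: with \<open>h = x - 1\<close>, the inner binomial
  coefficients are divisible by \<open>p\<close>, so \<open>x ^ p - 1\<close> and
  \<open>h ^ p\<close> have the same residue.\<close>

lemma pnorm_power_p_minus_1:
  assumes "pnorm x \<le> 1" "pnorm (x ^ p - 1) < 1"
  shows "pnorm (x - 1) < 1"
proof -
  define h where "h = x - 1"
  have h: "pnorm h \<le> 1" unfolding h_def using assms by (intro nrm_diff_leI) auto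
  obtain q where q: "p = Suc q" using prime_gt_0_nat[OF prime_p] by (cases p) auto
  have "x ^ p = (h + 1) ^ p" by (simp add: h_def)
  also have "\<dots> = (\<Sum>k\<le>p. of_nat (p choose k) * h ^ k)"
    by (subst binomial_ring) simp
  also have "\<dots> = 1 + (\<Sum>k\<in>{0<..<p}. of_nat (p choose k) * h ^ k) + h ^ p"
  proof -
    have "{..p} = insert 0 (insert p {0<..<p})" using q by auto
    thus ?thesis using q by simp
  qed
  finally have "h ^ p = (x ^ p - 1) - (\<Sum>k\<in>{0<..<p}. of_nat (p choose k) * h ^ k)"
    by (simp add: algebra_simps)
  also have "pnorm \<dots> < 1"
  proof (rule nrm_diff_lessI[OF assms(2) nrm_sum_lessI])
    fix k assume "k \<in> {0<..<p}"
    hence "p dvd (p choose k)" using prime_p by (intro dvd_choose_prime) auto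
    hence "pnorm (of_nat (p choose k)) < 1"
      using pnorm_of_int_less_1[of "int (p choose k)"] by simp
    thus "pnorm (of_nat (p choose k) * h ^ k) < 1"
      using h mult_left_le[of "pnorm (h ^ k)" "pnorm (of_nat (p choose k))"]
      by (simp add: nrm_mult nrm_power power_le_one)
  qed simp
  finally have "pnorm h ^ p < 1" by (simp add: nrm_power)
  thus ?thesis using one_le_power[of "pnorm h" p] unfolding h_def by linarith
qed

text \<open>By density of \<open>Qpbar\<close>, \<open>u\<close> has the residue of an algebraic
  unit, hence a residue of finite order \<open>n\<close>. This order is prime to \<open>p\<close>,
  so \<open>X^n - 1\<close> has unit derivative at \<open>u\<close>, and Newton's method lifts the
  residue to a root of unity in \<open>L\<close>.\<close>

lemma ex_teichmueller:
  assumes L: "subfield L CR" "closed L" and u: "u \<in> L" "pnorm u = 1"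
  obtains z where "z \<in> L \<inter> Qpbar" "pnorm (u - z) < 1"
proof -
  have "u \<in> closure Qpbar" using Qpbar_dense by simp
  then obtain a where a: "a \<in> Qpbar" "pnorm (u - a) < 1"
    unfolding closure_nrm using zero_less_one by blast
  hence "pnorm a = 1" using nrm_eq_of_diff_less u by metis
  then obtain n0 where n0: "n0 > 0" "pnorm (a ^ n0 - 1) < 1"
    using Qpbar_residue_torsion a(1) by blast
  have "pnorm (poly (Polynomial.monom 1 n0) u - poly (Polynomial.monom 1 n0) a) \<le> pnorm (u - a)"
    using u \<open>pnorm a = 1\<close> by (intro nrm_poly_diff_le) auto
  hence "pnorm (u ^ n0 - a ^ n0) < 1" using a by (simp add: poly_monom)
  hence ex: "n0 > 0 \<and> pnorm (u ^ n0 - 1) < 1" using n0 nrm_trans_less by blast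
  \<comment> \<open>Minimality excludes \<open>p dvd n\<close>, since otherwise \<open>n / p\<close>
    would serve by injectivity of Frobenius.\<close>
  define n where "n = (LEAST n. n > 0 \<and> pnorm (u ^ n - 1) < 1)"
  have n: "n > 0" "pnorm (u ^ n - 1) < 1"
    using LeastI[of "\<lambda>n. n > 0 \<and> pnorm (u ^ n - 1) < 1", OF ex] unfolding n_def by auto
  have least: "n \<le> m" if "m > 0" "pnorm (u ^ m - 1) < 1" for m
    unfolding n_def using that by (intro Least_le) auto
  have "\<not> p dvd n"
  proof
    assume "p dvd n"
    then obtain m where m: "n = m * p" by (metis dvdE mult.commute)
    have "pnorm (u ^ m - 1) < 1"
    proof (rule pnorm_power_p_minus_1)
      show "pnorm (u ^ m) \<le> 1" using u by (simp add: nrm_power)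
      show "pnorm ((u ^ m) ^ p - 1) < 1" using n(2) by (simp only: m power_mult)
    qed
    moreover have "m > 0" "m < n" using n(1) m p_gt_1 by auto
    ultimately show False using least[of m] by auto
  qed
  define g where "g = Polynomial.monom 1 n - (1 :: 'a poly)"
  have g: "poly g x = x ^ n - 1" for x by (simp add: g_def poly_monom)
  have co: "poly.coeff g i = (if i = n then 1 else 0) - (if i = 0 then 1 else 0)" for i
    by (auto simp: g_def)
  have g': "pnorm (poly (pderiv g) u) = 1"
    using u pnorm_of_nat_eq_1[OF \<open>\<not> p dvd n\<close>]
    by (simp add: g_def pderiv_diff pderiv_monom poly_monom nrm_mult nrm_power)
  obtain z where z: "z \<in> L" "poly g z = 0" "pnorm (z - u) \<le> pnorm (poly g u)"
  proof (rule newton_root[OF L, of u g "pnorm (poly g u)"])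
    show "poly.coeff g i \<in> L" for i
      unfolding co by (auto intro!: subfield_CR_closed[OF L(1)])
    show "pnorm (poly.coeff g i) \<le> 1" for i
      unfolding co using n(1) by auto
  qed (use u n g' in \<open>auto simp: g\<close>)
  have "z \<in> Qpbar"
  proof (rule Qpbar_root_closed)
    have "poly.coeff g n = 1" using n(1) by (simp add: co)
    thus "g \<noteq> 0" by auto
    show "poly.coeff g i \<in> Qpbar" for i
      unfolding co by (auto intro!: subfield_CR_closed[OF subfield_Qpbar])
  qed fact
  thus ?thesis using that z n(2) by (simp add: g nrm_minus_commute)
qed

text \<open>One step of the digit expansion: \<open>y\<close> supplies the norm of \<open>x\<close>,
  and \<open>z\<close> represents the residue of the unit \<open>x / y\<close>.\<close>

lemma ex_digit:
  assumes L: "subfield L CR" "closed L" and "x \<in> L" "x \<noteq> 0" "y \<in> L" "pnorm y = pnorm x"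
  obtains z where "z \<in> L \<inter> Qpbar" "pnorm (x - z * y) < pnorm x"
proof -
  have "y \<noteq> 0" using assms by auto
  obtain z where z: "z \<in> L \<inter> Qpbar" "pnorm (x / y - z) < 1"
    using ex_teichmueller[OF L, of "x / y"] subfield_CR_divide[OF L(1) assms(3,5)] assms(4,6)
    by (auto simp: nrm_divide)
  have "x - z * y = (x / y - z) * y" using \<open>y \<noteq> 0\<close> by (simp add: field_simps)
  hence "pnorm (x - z * y) < pnorm x"
    using z assms(4,6) by (simp add: nrm_mult)
  thus ?thesis using that z by blast
qed

section \<open>The value group\<close>

lemma v_1: "v 1 = 0"
  using val_mult[of 1 1] by simp

lemma v_inverse: "x \<noteq> 0 \<Longrightarrow> v (inverse x) = - v x"
  using val_mult[of x "inverse x"] v_1 by simp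

lemma v_power: "x \<noteq> 0 \<Longrightarrow> v (x ^ n) = of_nat n * v x"
  by (induction n) (auto simp: v_1 val_mult algebra_simps)

lemma v_power_int: "x \<noteq> 0 \<Longrightarrow> v (x powi n) = of_int n * v x"
  by (auto simp: power_int_def v_power v_inverse)

lemma v_p: "v (of_nat p) = 1"
  using val_of_int[of "int p"] prime_p by (auto simp: prime_gt_0_nat)

text \<open>With \<open>N\<close> cosets, two of the multiples \<open>0, v x, ..., N * v x\<close>
  agree modulo the integers, so some positive integer up to \<open>N\<close> makes
  \<open>v x\<close> integral. The factorial of \<open>N\<close> does so for all \<open>x\<close> at
  once.\<close>

lemma value_group_commensurable:
  assumes F: "subfield F CR" and fin: "finite (coset_space (value_group v F) \<int>)"
  obtains m :: nat where "m > 0" "\<And>x. x \<in> F \<Longrightarrow> x \<noteq> 0 \<Longrightarrow> real m * v x \<in> \<int>"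
proof -
  define N where "N = card (coset_space (value_group v F) \<int>)"
  have "real (fact N) * v x \<in> \<int>" if x: "x \<in> F" "x \<noteq> 0" for x
  proof -
    define f where "f k = (+) (real k * v x) ` \<int>" for k
    have "f k \<in> coset_space (value_group v F) \<int>" for k
    proof -
      have "real k * v x \<in> value_group v F"
        unfolding value_group_def v_power[OF x(2), symmetric]
        using x by (auto intro: subfield_CR_power[OF F])
      thus ?thesis by (auto simp: f_def coset_space_def)
    qed
    hence "card (f ` {..N}) \<le> N"
      unfolding N_def using fin by (intro card_mono) auto
    hence "\<not> inj_on f {..N}" using card_image[of f "{..N}"] by auto
    then obtain j k where jk: "j < k" "k \<le> N" "f j = f k"
      unfolding inj_on_def by (metis atMost_iff linorder_neqE_nat)
    have "real k * v x \<in> f k" unfolding f_def by (intro image_eqI[of _ _ 0]) auto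
    hence "real k * v x \<in> f j" using jk(3) by simp
    then obtain z where z: "z \<in> \<int>" "real k * v x = real j * v x + z"
      unfolding f_def by auto
    hence int: "real (k - j) * v x \<in> \<int>" using jk(1) by (simp add: of_nat_diff algebra_simps)
    have "(k - j) dvd fact N" using jk by (intro dvd_fact) auto
    then obtain q where "fact N = (k - j) * q" by (auto elim: dvdE)
    hence "real (fact N) * v x = real q * (real (k - j) * v x)"
      by (metis mult.assoc mult.commute of_nat_mult)
    also have "\<dots> \<in> \<int>" by (intro Ints_mult int) auto
    finally show ?thesis .
  qed
  thus ?thesis using that[of "fact N"] by simp
qed

text \<open>The values \<open>m * v x\<close> form a subgroup of the integers, nonzero because
  \<open>v p = 1\<close>; division with remainder shows that its least positive element generates
  it.\<close>

lemma ex_uniformizer: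
  assumes L: "subfield L CR" and m: "m > 0" "\<And>x. x \<in> L \<Longrightarrow> x \<noteq> 0 \<Longrightarrow> real m * v x \<in> \<int>"
  obtains \<pi> where "\<pi> \<in> L" "0 < pnorm \<pi>" "pnorm \<pi> < 1"
    "\<And>x. x \<in> L \<Longrightarrow> x \<noteq> 0 \<Longrightarrow> \<exists>k::int. pnorm x = pnorm \<pi> powi k"
proof -
  define P where "P k \<longleftrightarrow> k > 0 \<and> (\<exists>x\<in>L - {0}. real m * v x = real k)" for k :: nat
  have ex: "P m"
    using m prime_p
    by (auto simp: P_def v_p prime_gt_0_nat intro!: bexI[of _ "of_nat p"] subfield_CR_of_nat[OF L])
  define k0 where "k0 = (LEAST k. P k)"
  have "P k0" unfolding k0_def using ex by (rule LeastI)
  then obtain \<pi> where \<pi>: "k0 > 0" "\<pi> \<in> L" "\<pi> \<noteq> 0" "real m * v \<pi> = real k0"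
    by (auto simp: P_def)
  have least: "k0 \<le> k" if "P k" for k unfolding k0_def using that by (rule Least_le)
  have "v \<pi> > 0" using \<pi> m(1) by (metis of_nat_0_less_iff zero_less_mult_pos)
  hence "pnorm \<pi> < 1" using \<pi>(3) p_gt_1 by (simp add: pnorm_def powr_minus field_simps)
  moreover have "\<exists>k::int. pnorm x = pnorm \<pi> powi k" if x: "x \<in> L" "x \<noteq> 0" for x
  proof -
    obtain z :: int where z: "real m * v x = of_int z" using m(2)[OF x] by (auto elim: Ints_cases)
    define q where "q = z div int k0"
    define y where "y = x * \<pi> powi (- q)"
    have y: "y \<in> L" "y \<noteq> 0"
      using x \<pi> by (auto simp: y_def intro!: subfield_CR_mult[OF L] subfield_CR_power_int[OF L])
    have "real m * v y = real m * v x - of_int q * (real m * v \<pi>)"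
      using x \<pi> by (simp add: y_def val_mult v_power_int algebra_simps)
    also have "\<dots> = of_int (z - q * int k0)" using z \<pi> by simp
    also have "z - q * int k0 = z mod int k0" by (simp add: q_def minus_div_mult_eq_mod)
    finally have vy: "real m * v y = of_int (z mod int k0)" .
    have "z mod int k0 = 0"
    proof (rule ccontr)
      assume "z mod int k0 \<noteq> 0"
      moreover have "0 \<le> z mod int k0" "z mod int k0 < int k0" using \<pi>(1) by auto
      ultimately have "P (nat (z mod int k0))" "nat (z mod int k0) < k0"
        using vy y by (auto simp: P_def)
      thus False using least by fastforce
    qed
    hence "v y = 0" using vy m(1) by simp
    hence "pnorm y = 1" using y p_gt_1 by (simp add: pnorm_def)
    moreover have "x = y * \<pi> powi q" using \<pi>(3) by (simp add: y_def power_int_minus)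
    ultimately show ?thesis by (auto simp: nrm_mult nrm_power_int)
  qed
  ultimately show ?thesis using that[of \<pi>] \<pi> by simp
qed

text \<open>
  With \<open>e\<close> least such that \<open>pnorm \<pi> ^ e\<close> is a norm of \<open>M = L \<inter> Qpbar\<close>, the element \<open>\<pi>\<close> is nearly a
  root of a polynomial \<open>g = X^e - (\<Sum>i<e. c i * X^i)\<close> over \<open>M\<close>. The terms of \<open>g' \<pi>\<close> have distinct norms,
  which bounds \<open>g' \<pi>\<close> from below independently of the quality of the approximation, so Newton's
  method applies.
\<close>

lemma ex_algebraic_uniformizer:
  assumes L: "subfield L CR" "closed L"
    and \<pi>: "\<pi> \<in> L" "0 < pnorm \<pi>" "pnorm \<pi> < 1"
      "\<And>x. x \<in> L \<Longrightarrow> x \<noteq> 0 \<Longrightarrow> \<exists>k::int. pnorm x = pnorm \<pi> powi k"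
  obtains b where "b \<in> L \<inter> Qpbar" "pnorm b = pnorm \<pi>"
proof -
  define M where "M = L \<inter> Qpbar"
  define \<rho> where "\<rho> = pnorm \<pi>"
  have rho: "0 < \<rho>" "\<rho> < 1" using \<pi> by (auto simp: \<rho>_def)
  have M: "subfield M CR" unfolding M_def by (intro subfield_CR_Int L subfield_Qpbar)
  define P where "P e \<longleftrightarrow> e > 0 \<and> (\<exists>c\<in>M - {0}. pnorm c = \<rho> ^ e)" for e
  have "\<exists>e. P e"
  proof -
    have p: "of_nat p \<in> M" "of_nat p \<noteq> (0::'a)"
      using prime_p by (auto intro: subfield_CR_of_nat[OF M])
    then obtain k :: int where k: "pnorm (of_nat p) = \<rho> powi k"
      using \<pi>(4)[of "of_nat p"] unfolding M_def \<rho>_def by blast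
    have "k > 0"
    proof (rule ccontr)
      assume "\<not> k > 0"
      hence "\<rho> powi 0 \<le> \<rho> powi k" using rho by (intro power_int_decreasing) auto
      thus False using pnorm_p_less_1 k by simp
    qed
    hence "P (nat k)" using p k by (auto simp: P_def power_int_def)
    thus ?thesis ..
  qed
  define e where "e = (LEAST e. P e)"
  have "P e" unfolding e_def using \<open>\<exists>e. P e\<close> by (rule LeastI_ex)
  then obtain w where w: "e > 0" "w \<in> M" "w \<noteq> 0" "pnorm w = \<rho> ^ e" by (auto simp: P_def)
  have least: "e \<le> k" if "P k" for k unfolding e_def using that by (rule Least_le)
  \<comment> \<open>Equal norms with \<open>i < j < e\<close> would make \<open>c / d\<close> an
    element of \<open>M\<close> of norm \<open>\<rho> ^ (j - i)\<close>, against the minimality of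
    \<open>e\<close>. So nonzero terms \<open>c i * \<pi> ^ i\<close> with \<open>i < e\<close> have
    distinct norms.\<close>
  have not_less: "\<not> i < j"
    if "c \<in> M" "d \<in> M" "c \<noteq> 0" "j < e" "pnorm (c * \<pi> ^ i) = pnorm (d * \<pi> ^ j)" for i j c d
  proof
    assume "i < j"
    have "pnorm c * \<rho> ^ i = pnorm d * \<rho> ^ (j - i) * \<rho> ^ i"
      using that(5) \<open>i < j\<close> by (simp add: nrm_mult nrm_power \<rho>_def flip: power_add)
    hence eq: "pnorm c = pnorm d * \<rho> ^ (j - i)" using rho by simp
    hence "d \<noteq> 0" using that(3) by auto
    hence "pnorm (c / d) = \<rho> ^ (j - i)" using eq by (simp add: nrm_divide)
    hence "P (j - i)"
      using that \<open>i < j\<close> \<open>d \<noteq> 0\<close> by (auto simp: P_def intro!: bexI[of _ "c / d"] subfield_CR_divide[OF M])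
    thus False using least that(4) \<open>i < j\<close> by fastforce
  qed
  have le_sum: "pnorm (c i * \<pi> ^ i) \<le> pnorm (\<Sum>i<e. c i * \<pi> ^ i)"
    if c: "\<And>i. c i \<in> M" and "i < e" for c i
  proof (rule nrm_le_sum_distinct)
    fix i j assume ij: "i \<in> {..<e}" "j \<in> {..<e}" "c i * \<pi> ^ i \<noteq> 0"
      "pnorm (c i * \<pi> ^ i) = pnorm (c j * \<pi> ^ j)"
    moreover have "pnorm (c j * \<pi> ^ j) \<noteq> 0" using ij(3,4) by (metis nrm_eq_0_iff)
    hence "c j \<noteq> 0" by auto
    ultimately show "i = j"
      using not_less[of "c i" "c j" j i] not_less[of "c j" "c i" i j] c by fastforce
  qed (use that in auto)
  define S where "S = {\<Sum>i<e. c i * \<pi> ^ i | c. \<forall>i. c i \<in> M}"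
  have dense: "x \<in> closure S" if "x \<in> L" for x
  proof (rule dense_if_approx[of \<rho> L])
    show "S \<subseteq> L"
      using \<pi> by (auto simp: S_def M_def intro!: subfield_CR_sum[OF L(1)] subfield_CR_mult[OF L(1)]
          subfield_CR_power[OF L(1)])
    show "0 \<in> S" unfolding S_def using subfield_CR_0[OF M] by (auto intro!: exI[of _ "\<lambda>_. 0"])
    show "x + y \<in> S" if xy: "x \<in> S" "y \<in> S" for x y
    proof -
      obtain c d where "\<forall>i. c i \<in> M" "x = (\<Sum>i<e. c i * \<pi> ^ i)" "\<forall>i. d i \<in> M" "y = (\<Sum>i<e. d i * \<pi> ^ i)"
        using xy unfolding S_def by blast
      thus ?thesis unfolding S_def
        by (auto intro!: exI[of _ "\<lambda>i. c i + d i"] subfield_CR_add[OF M] simp: sum.distrib algebra_simps)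
    qed
    show "\<exists>y\<in>S. pnorm (x - y) < pnorm x" if x: "x \<in> L" "x \<noteq> 0" for x
    proof -
      obtain k :: int where k: "pnorm x = \<rho> powi k" using \<pi>(4)[OF x] by (auto simp: \<rho>_def)
      \<comment> \<open>Division by \<open>e\<close> splits the norm \<open>\<rho> powi k\<close>
        into a power of \<open>w\<close>, which lies in \<open>M\<close>, and a factor
        \<open>\<pi> ^ r\<close> with \<open>r < e\<close>.\<close>
      define r where "r = nat (k mod int e)"
      have r: "r < e" "k = int e * (k div int e) + int r" using w(1) by (simp_all add: r_def nat_less_iff)
      define z where "z = w powi (k div int e)"
      have "z \<in> M" unfolding z_def by (intro subfield_CR_power_int[OF M] w)
      have "\<rho> powi k = \<rho> powi (int e * (k div int e)) * \<rho> ^ r"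
        using rho by (subst r(2)) (simp add: power_int_add)
      hence "pnorm (z * \<pi> ^ r) = pnorm x"
        by (simp add: k z_def nrm_mult nrm_power_int nrm_power w(4) \<rho>_def[symmetric] power_int_mult)
      moreover have "z * \<pi> ^ r \<in> L"
        using \<open>z \<in> M\<close> \<pi> by (auto simp: M_def intro: subfield_CR_mult[OF L(1)] subfield_CR_power[OF L(1)])
      ultimately obtain u where u: "u \<in> M" "pnorm (x - u * (z * \<pi> ^ r)) < pnorm x"
        using ex_digit[OF L x] unfolding M_def by blast
      have "(\<Sum>i<e. (if i = r then u * z else 0) * \<pi> ^ i) = u * (z * \<pi> ^ r)"
        using r(1) by (simp add: if_distrib[of "\<lambda>x. x * _"] mult.assoc cong: if_cong)
      moreover have "(if i = r then u * z else 0) \<in> M" for i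
        using u \<open>z \<in> M\<close> by (auto intro: subfield_CR_mult[OF M] subfield_CR_0[OF M])
      ultimately have "u * (z * \<pi> ^ r) \<in> S" unfolding S_def
        by (intro CollectI exI[of _ "\<lambda>i. if i = r then u * z else 0"]) auto
      thus ?thesis using u by blast
    qed
  qed (use rho \<pi>(4) L that in \<open>auto simp: \<rho>_def\<close>)
  \<comment> \<open>The norm of \<open>e * \<pi> ^ (e - 1)\<close>, the leading term of
    \<open>g' \<pi>\<close>. It does not involve the coefficients \<open>c i\<close>, so the
    precision can be fixed before they are chosen.\<close>
  define \<eta> where "\<eta> = pnorm (of_nat e) * \<rho> ^ (e - 1)"
  \<comment> \<open>Radius of the Newton ball: below \<open>\<eta>\<close> for convergence, below
    \<open>\<rho>\<close> so that the root keeps the norm of \<open>\<pi>\<close>.\<close>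
  define \<epsilon> where "\<epsilon> = min (\<eta> / 2) (\<rho> / 2)"
  have "\<eta> > 0" using w(1) rho by (simp add: \<eta>_def)
  hence eps: "\<epsilon> > 0" "\<epsilon> < \<eta>" "\<epsilon> < \<rho>" using rho by (auto simp: \<epsilon>_def)
  have "\<pi> ^ e \<in> closure S" by (intro dense subfield_CR_power[OF L(1)] \<pi>)
  \<comment> \<open>The bound \<open>\<rho> ^ e\<close> gives \<open>y\<close> the norm of
    \<open>\<pi> ^ e\<close>, which makes the coefficients integral; the bound
    \<open>\<epsilon> * \<eta>\<close> is Newton's condition on \<open>g \<pi>\<close>.\<close>
  moreover have "min (\<rho> ^ e) (\<epsilon> * \<eta>) > 0" using rho eps \<open>\<eta> > 0\<close> by simp
  ultimately obtain y where y: "y \<in> S" "pnorm (\<pi> ^ e - y) < min (\<rho> ^ e) (\<epsilon> * \<eta>)"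
    unfolding closure_nrm by blast
  then obtain c where c: "\<And>i. c i \<in> M" "y = (\<Sum>i<e. c i * \<pi> ^ i)" by (auto simp: S_def)
  have "pnorm y = \<rho> ^ e"
    using nrm_eq_of_diff_less[of "\<pi> ^ e" y] y by (simp add: nrm_power \<rho>_def)
  have c_le: "pnorm (c i) \<le> 1" if "i < e" for i
  proof -
    have "pnorm (c i) * \<rho> ^ i \<le> \<rho> ^ e"
      using le_sum[of c i] c that \<open>pnorm y = \<rho> ^ e\<close> by (simp add: nrm_mult nrm_power \<rho>_def)
    also have "\<dots> \<le> 1 * \<rho> ^ i" using rho that by (simp add: power_decreasing)
    finally show ?thesis using rho by (simp only: mult_le_cancel_right) auto
  qed
  define g where "g = Polynomial.monom 1 e - (\<Sum>i<e. Polynomial.monom (c i) i)"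
  have co: "poly.coeff g i = (if i = e then 1 else 0) - (if i < e then c i else 0)" for i
    by (auto simp: g_def coeff_sum)
  have co_M: "poly.coeff g i \<in> M" for i
    unfolding co using c(1) by (auto intro!: subfield_CR_closed[OF M])
  have g_pi: "poly g \<pi> = \<pi> ^ e - y"
    by (simp add: g_def poly_sum poly_monom c(2))
  \<comment> \<open>The coefficients of \<open>g'\<close> are again in \<open>M\<close> and its
    degree is below \<open>e\<close>, so no cancellation occurs and the leading term is a lower
    bound.\<close>
  have D: "\<eta> \<le> pnorm (poly (pderiv g) \<pi>)"
  proof -
    have "poly (pderiv g) \<pi> = (\<Sum>i<e. poly.coeff (pderiv g) i * \<pi> ^ i)"
      by (rule poly_eq_sum_lessThan) (auto simp: coeff_pderiv co)
    moreover have "poly.coeff (pderiv g) i \<in> M" for i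
      unfolding coeff_pderiv by (intro subfield_CR_mult[OF M] subfield_CR_of_nat[OF M] co_M)
    moreover have "pnorm (poly.coeff (pderiv g) (e - 1) * \<pi> ^ (e - 1)) = \<eta>"
      using w(1) by (simp add: coeff_pderiv co \<eta>_def nrm_mult nrm_power \<rho>_def del: of_nat_Suc)
    ultimately show ?thesis using le_sum[of "poly.coeff (pderiv g)" "e - 1"] w(1) by simp
  qed
  obtain b where b: "b \<in> L" "poly g b = 0" "pnorm (b - \<pi>) \<le> \<epsilon>"
  proof (rule newton_root[OF L, of \<pi> g \<epsilon>])
    show "poly.coeff g i \<in> L" for i using co_M by (auto simp: M_def)
    show "pnorm (poly.coeff g i) \<le> 1" for i using c_le by (auto simp: co)
    have "pnorm (poly g \<pi>) \<le> \<epsilon> * \<eta>" using y by (simp add: g_pi)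
    also have "\<dots> \<le> \<epsilon> * pnorm (poly (pderiv g) \<pi>)" using D eps by (intro mult_left_mono) auto
    finally show "pnorm (poly g \<pi>) \<le> \<epsilon> * pnorm (poly (pderiv g) \<pi>)" .
  qed (use \<pi> eps D in auto)
  have "poly.coeff g e = 1" by (simp add: co)
  hence "g \<noteq> 0" by auto
  moreover have "poly.coeff g i \<in> Qpbar" for i using co_M by (simp add: M_def)
  ultimately have "b \<in> Qpbar" using b(2) by (rule Qpbar_root_closed)
  moreover have "pnorm b = pnorm \<pi>"
    using nrm_eq_of_diff_less[of \<pi> b] b(3) eps by (simp add: nrm_minus_commute \<rho>_def)
  ultimately show ?thesis using that b by auto
qed

section \<open>Finite extensions inside \<open>Qpbar\<close> and their ramification\<close>

lemma finite_ext_simple_extension: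
  assumes K: "subfield K CR" "Qp \<subseteq> K" "K \<subseteq> Qpbar" and b: "b \<in> Qpbar"
  shows "finite_ext_in Qpbar K (ring.simple_extension CR K b)"
proof -
  have alg: "ring.algebraic CR K b"
    using ring.algebraic_mono[OF CR_ring K(2), unfolded over_def] algebraic_Qpbar[OF b] by blast
  show ?thesis unfolding finite_ext_in_def
  proof (intro conjI K(1))
    show "subfield (ring.simple_extension CR K b) CR"
      using domain.simple_extension_is_subfield[OF CR_domain K(1), of b] alg by (simp add: over_def)
    show "K \<subseteq> ring.simple_extension CR K b"
      by (rule ring.simple_extension_incl[OF CR_ring]) auto
    show "ring.simple_extension CR K b \<subseteq> Qpbar"
      by (rule ring.simple_extension_subring_incl[OF CR_ring subfieldE(1)[OF subfield_Qpbar] K(3) b])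
    show "ring.finite_dimension CR K (ring.simple_extension CR K b)"
      using domain.finite_dimension_simple_extension[OF CR_domain K(1), of b] alg by (simp add: over_def)
  qed
qed

lemma ramification_index_eq_1:
  assumes K: "subfield K CR" and eq: "value_group v L = value_group v K"
  shows "ramification_index v K L = 1"
proof -
  have "(+) g ` value_group v K = value_group v K" if "g \<in> value_group v K" for g
  proof -
    obtain x where x: "x \<in> K" "x \<noteq> 0" "g = v x" using \<open>g \<in> value_group v K\<close> by (auto simp: value_group_def)
    show ?thesis
    proof (intro equalityI subsetI)
      fix h assume "h \<in> (+) g ` value_group v K"
      then obtain y where y: "y \<in> K" "y \<noteq> 0" "h = g + v y" by (auto simp: value_group_def)
      hence "h = v (x * y)" using x by (simp add: val_mult)
      thus "h \<in> value_group v K"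
        using x y by (auto simp: value_group_def intro: subfield_CR_mult[OF K])
    next
      fix h assume "h \<in> value_group v K"
      then obtain y where y: "y \<in> K" "y \<noteq> 0" "h = v y" by (auto simp: value_group_def)
      hence "h = g + v (y * inverse x)" using x by (simp add: val_mult v_inverse)
      moreover have "v (y * inverse x) \<in> value_group v K" unfolding value_group_def using x y
        by (intro imageI) (auto intro: subfield_CR_mult[OF K] subfield_CR_inverse[OF K])
      ultimately show "h \<in> (+) g ` value_group v K" by (rule image_eqI)
    qed
  qed
  hence "coset_space (value_group v K) (value_group v K) \<subseteq> {value_group v K}"
    by (auto simp: coset_space_def)
  moreover have "v 1 \<in> value_group v K"
    by (auto simp: value_group_def intro: subfield_CR_1[OF K])
  ultimately have "coset_space (value_group v K) (value_group v K) = {value_group v K}"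
    by (auto simp: coset_space_def)
  thus ?thesis by (simp add: ramification_index_def eq)
qed

lemma Cp_br_limit_unramified:
  assumes t: "t \<in> Cp_br v Qp"
  shows "\<exists>K. finite_ext_in Qpbar Qp K \<and> t \<in> closure (max_unramified_ext v Qpbar K)"
proof -
  define F where "F = generate_field CR (insert t Qp)"
  define L where "L = closure F"
  have F: "subfield F CR" "insert t Qp \<subseteq> F"
    unfolding F_def by (auto intro: field.generate_field_is_subfield[OF CR_field] generate_field.incl)
  have L: "subfield L CR" "closed L"
    unfolding L_def using F by (auto intro: subfield_closure)
  have "F \<subseteq> L" unfolding L_def by (rule closure_subset)
  hence "t \<in> L" "Qp \<subseteq> L" using F by auto
  obtain m where m: "m > 0" "\<And>x. x \<in> F \<Longrightarrow> x \<noteq> 0 \<Longrightarrow> real m * v x \<in> \<int>"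
    using value_group_commensurable[OF F(1)] t by (auto simp: Cp_br_def F_def)
  \<comment> \<open>Completion does not enlarge the value group: an element of \<open>F\<close>
    close enough to \<open>x\<close> has the norm of \<open>x\<close>.\<close>
  have mL: "real m * v x \<in> \<int>" if x: "x \<in> L" "x \<noteq> 0" for x
  proof -
    have "pnorm x > 0" using x by simp
    then obtain y where y: "y \<in> F" "pnorm (x - y) < pnorm x"
      using x(1) unfolding L_def closure_nrm by blast
    hence "pnorm y = pnorm x" by (intro nrm_eq_of_diff_less)
    moreover from this have "y \<noteq> 0" using x by auto
    ultimately have "v x = v y" using x pnorm_eq_iff[of y x] by simp
    thus ?thesis using m y \<open>y \<noteq> 0\<close> by simp
  qed
  obtain \<pi>0 where \<pi>0: "\<pi>0 \<in> L" "0 < pnorm \<pi>0" "pnorm \<pi>0 < 1"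
    "\<And>x. x \<in> L \<Longrightarrow> x \<noteq> 0 \<Longrightarrow> \<exists>k::int. pnorm x = pnorm \<pi>0 powi k"
    using ex_uniformizer[OF L(1) m(1) mL] by blast
  obtain \<pi> where \<pi>: "\<pi> \<in> L \<inter> Qpbar" "pnorm \<pi> = pnorm \<pi>0"
    using ex_algebraic_uniformizer[OF L \<pi>0] by blast
  define M where "M = L \<inter> Qpbar"
  have M: "subfield M CR" unfolding M_def by (intro subfield_CR_Int L subfield_Qpbar)
  define K where "K = ring.simple_extension CR Qp \<pi>"
  have K_ext: "finite_ext_in Qpbar Qp K"
    unfolding K_def by (rule finite_ext_simple_extension) (use subfield_Qp Qp_subset_Qpbar \<pi> in auto)
  hence K: "subfield K CR" "Qp \<subseteq> K" "K \<subseteq> Qpbar" by (auto simp: finite_ext_in_def)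
  have "Qp \<subseteq> M" using \<open>Qp \<subseteq> L\<close> Qp_subset_Qpbar by (auto simp: M_def)
  hence "K \<subseteq> M"
    unfolding K_def using \<pi>
    by (intro ring.simple_extension_subring_incl[OF CR_ring subfieldE(1)[OF M]]) (auto simp: M_def)
  have "\<pi> \<in> K"
    unfolding K_def by (intro ring.simple_extension_mem[OF CR_ring subfieldE(1)[OF subfield_Qp]]) auto
  \<comment> \<open>\<open>M\<close> may have infinite degree over \<open>K\<close>, so each
    \<open>b\<close> is treated through the finite extension \<open>K(b)\<close>. It lies between
    \<open>K\<close> and \<open>L\<close>, whose values are all multiples of \<open>v \<pi>\<close>
    with \<open>\<pi>\<close> in \<open>K\<close>.\<close>
  have unram: "M \<subseteq> max_unramified_ext v Qpbar K"
  proof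
    fix b assume b: "b \<in> M"
    define Kb where "Kb = ring.simple_extension CR K b"
    have fin: "finite_ext_in Qpbar K Kb"
      unfolding Kb_def using K b by (intro finite_ext_simple_extension) (auto simp: M_def)
    hence "K \<subseteq> Kb" by (auto simp: finite_ext_in_def)
    have "Kb \<subseteq> M"
      unfolding Kb_def
      by (intro ring.simple_extension_subring_incl[OF CR_ring subfieldE(1)[OF M]] \<open>K \<subseteq> M\<close> b)
    have "value_group v Kb = value_group v K"
    proof
      show "value_group v K \<subseteq> value_group v Kb" using \<open>K \<subseteq> Kb\<close> by (auto simp: value_group_def)
      show "value_group v Kb \<subseteq> value_group v K"
      proof
        fix h assume "h \<in> value_group v Kb"
        then obtain x where x: "x \<in> Kb" "x \<noteq> 0" "h = v x" by (auto simp: value_group_def)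
        then obtain k :: int where k: "pnorm x = pnorm (\<pi> powi k)"
          using \<pi>0(4)[of x] \<open>Kb \<subseteq> M\<close> \<pi>(2) by (auto simp: M_def nrm_power_int)
        have "\<pi> \<noteq> 0" using \<pi> \<pi>0 by auto
        hence "h = v (\<pi> powi k)" using x k pnorm_eq_iff[of x "\<pi> powi k"] by simp
        thus "h \<in> value_group v K"
          using \<open>\<pi> \<noteq> 0\<close> subfield_CR_power_int[OF K(1) \<open>\<pi> \<in> K\<close>, of k] by (auto simp: value_group_def)
      qed
    qed
    hence "unramified_ext_in v Qpbar K Kb"
      using fin ramification_index_eq_1[OF K(1)] by (auto simp: unramified_ext_in_def)
    moreover have "b \<in> Kb"
      unfolding Kb_def by (intro ring.simple_extension_mem[OF CR_ring subfieldE(1)[OF K(1)]]) auto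
    ultimately show "b \<in> max_unramified_ext v Qpbar K" by (auto simp: max_unramified_ext_def)
  qed
  have "t \<in> closure M"
  \<comment> \<open>Now the powers of \<open>\<pi>\<close> are themselves in \<open>M\<close>, so
    digit times power is an approximation within \<open>M\<close>.\<close>
  proof (rule dense_if_approx[of "pnorm \<pi>" L])
    show "\<exists>y\<in>M. pnorm (x - y) < pnorm x" if x: "x \<in> L" "x \<noteq> 0" for x
    proof -
      obtain k :: int where k: "pnorm (\<pi> powi k) = pnorm x"
        using \<pi>0(4)[OF x] \<pi>(2) by (auto simp: nrm_power_int)
      have "\<pi> powi k \<in> M" using \<pi> by (intro subfield_CR_power_int[OF M]) (auto simp: M_def)
      moreover from this obtain z where "z \<in> M" "pnorm (x - z * \<pi> powi k) < pnorm x"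
        using ex_digit[OF L x _ k] by (auto simp: M_def)
      ultimately show ?thesis by (auto intro: subfield_CR_mult[OF M])
    qed
  qed (use \<pi> \<pi>0 L \<open>t \<in> L\<close> in \<open>auto simp: M_def intro: subfield_CR_0[OF M, unfolded M_def]
        subfield_CR_closed[OF L(1)] subfield_CR_closed[OF subfield_Qpbar]\<close>)
  hence "t \<in> closure (max_unramified_ext v Qpbar K)" using closure_mono[OF unram] by blast
  thus ?thesis using K_ext by blast
qed

end

theorem proposition2p20:
  fixes p :: nat
    and v :: "'a::{field_char_0, complete_space} \<Rightarrow> real"
    and Qp Qpbar :: "'a set"
    and t :: 'a
  assumes "padic_complex_field p v Qp Qpbar"
    and "t \<in> Cp_br v Qp"
  shows "\<exists>K. finite_ext_in Qpbar Qp K \<and>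
           (\<exists>a :: nat \<Rightarrow> 'a. (\<forall>n. a n \<in> max_unramified_ext v Qpbar K) \<and> a \<longlonglongrightarrow> t)"
  using padic_complex_field.Cp_br_limit_unramified[OF assms] unfolding closure_sequential .

end
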